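(* Let $p_0\in\mathcal{W}^{s,2}$ be a density on $\mathbb{R}^d$ and let $(\Delta_n)$ be positive numbers with $n^{2s/(d+4s)}\Delta_n\to\infty$. Then for any $\alpha\in(0,1)$, $$\lim_{n\to\infty}{\rm power}\{\Phi^{\rm GOF}_{n,\nu_n,\alpha};H_1^{\rm GOF}(\Delta_n;s)\}=1,$$ provided that $\nu_n\asymp n^{4/(d+4s)}$.
   Context: Fix $d\ge1$, $s>0$, $M>0$. For $f:\mathbb{R}^d\to\mathbb{R}$ let $\mathcal{F}(f)(\omega)=(2\pi)^{-d/2}\int f(x)e^{-ix^\top\omega}dx$ be its Fourier transform, $\|f\|_{L_2}^2=\int f^2$, and $\|f\|_{\mathcal{W}^{s,2}}^2=\int(1+\|\omega\|^2)^s|\mathcal{F}(f)(\omega)|^2d\omega$. $\mathcal{W}^{s,2}$ is the set of $f:\mathbb{R}^d\to\mathbb{R}$ that are almost everywhere continuous with $\|f\|_{\mathcal{W}^{s,2}}<\infty$, and $\mathcal{W}^{s,2}(M)=\{f\in\mathcal{W}^{s,2}:\|f\|_{\mathcal{W}^{s,2}}\le M\}$. The notation $a_n\asymp b_n$ means that $a_n/b_n$ is bounded above and below by positive constants. $\mathbb{P}_0$ is the distribution with fixed known density $p_0$; $X_1,\dots,X_n$ are i.i.d. from a distribution $\mathbb{P}$ with density $p$. The null hypothesis is $H_0^{\rm GOF}:p=p_0$, and the alternative $H_1^{\rm GOF}(\Delta_n;s)$ is: $p\in\mathcal{W}^{s,2}(M)$ is a density with $\|p-p_0\|_{L_2}\ge\Delta_n$.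 The power of a test $\Phi$ is $${\rm power}\{\Phi;H_1^{\rm GOF}(\Delta_n;s)\}=\inf_{p\in\mathcal{W}^{s,2}(M),\ \|p-p_0\|_{L_2}\ge\Delta_n}\mathbb{P}\{\Phi\text{ rejects }H_0^{\rm GOF}\},$$ the probability being under $X_1,\dots,X_n\sim_{\rm iid}p$, and the infimum over an empty set being $1$. For $\nu>0$, $G_\nu(x,y)=\exp(-\nu\|x-y\|^2)$ and $$\bar G_\nu(x,y)=G_\nu(x,y)-\mathbb{E}_{X\sim\mathbb{P}_0}G_\nu(X,y)-\mathbb{E}_{X\sim\mathbb{P}_0}G_\nu(x,X)+\mathbb{E}_{X,X'\sim_{\rm iid}\mathbb{P}_0}G_\nu(X,X').$$ Define $$\widehat{\gamma_\nu^2}(\mathbb{P},\mathbb{P}_0)=\frac1{n(n-1)}\sum_{1\le i\ne j\le n}\bar G_\nu(X_i,X_j),$$ $$\tilde s_{n,\nu}^2=\frac1{n(n-1)}\sum_{i\ne j}G_{2\nu}(X_i,X_j)-\frac{2(n-3)!}{n!}\sum_{|\{i,j_1,j_2\}|=3}G_\nu(X_i,X_{j_1})G_\nu(X_i,X_{j_2})+\frac{(n-4)!}{n!}\sum_{|\{i_1,i_2,j_1,j_2\}|=4}G_\nu(X_{i_1},X_{j_1})G_\nu(X_{i_2},X_{j_2}),$$ where all indices range over $\{1,\ldots,n\}$, $\hat s_{n,\nu}^2=\max\{\tilde s_{n,\nu}^2,1/n^2\}$, and $T_{n,\nu}^{\rm GOF}=\frac{n}{\sqrt2}\,\hat s_{n,\nu}^{-1}\,\widehat{\gamma_\nu^2}(\mathbb{P},\mathbb{P}_0)$.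 The test $\Phi^{\rm GOF}_{n,\nu,\alpha}$ rejects $H_0^{\rm GOF}$ if and only if $T_{n,\nu}^{\rm GOF}>z_\alpha$, where $z_\alpha$ satisfies $\Pr(Z>z_\alpha)=\alpha$ for $Z\sim N(0,1)$. *)

theory Defs
  imports "HOL-Probability.Probability"
begin

definition fourier :: "('a::euclidean_space \<Rightarrow> real) \<Rightarrow> 'a \<Rightarrow> complex" where
  "fourier f \<omega> = of_real ((2 * pi) powr (- real DIM('a) / 2)) *
     (LINT x|lebesgue. of_real (f x) * exp (- (\<i> * of_real (x \<bullet> \<omega>))))"

definition L2_norm :: "('a::euclidean_space \<Rightarrow> real) \<Rightarrow> real" where
  "L2_norm f = sqrt (LINT x|lebesgue. (f x)\<^sup>2)"

definition sobolev_weighted :: "real \<Rightarrow> ('a::euclidean_space \<Rightarrow> real) \<Rightarrow> 'a \<Rightarrow> real" where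
  "sobolev_weighted s f \<omega> = (1 + (norm \<omega>)\<^sup>2) powr s * (cmod (fourier f \<omega>))\<^sup>2"

definition sobolev_norm :: "real \<Rightarrow> ('a::euclidean_space \<Rightarrow> real) \<Rightarrow> real" where
  "sobolev_norm s f = sqrt (LINT \<omega>|lebesgue. sobolev_weighted s f \<omega>)"

(* Integrability of f is what makes the integral defining fourier f meaningful (the Bochner
   integral of a non-integrable function is 0 by convention); the second integrability
   condition expresses that the Sobolev norm is finite. *)
definition sobolev :: "real \<Rightarrow> ('a::euclidean_space \<Rightarrow> real) set" where
  "sobolev s = {f. integrable lebesgue f \<and> (AE x in lebesgue. isCont f x) \<and>
     integrable lebesgue (sobolev_weighted s f)}"

definition sobolev_ball :: "real \<Rightarrow> real \<Rightarrow> ('a::euclidean_space \<Rightarrow> real) set" where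
  "sobolev_ball s M = {f \<in> sobolev s. sobolev_norm s f \<le> M}"

definition prob_density :: "('a::euclidean_space \<Rightarrow> real) \<Rightarrow> bool" where
  "prob_density p \<longleftrightarrow> integrable lebesgue p \<and> (\<forall>x. 0 \<le> p x) \<and> (LINT x|lebesgue. p x) = 1"

(* The Borel probability measure with density p. An almost everywhere continuous function is
   Lebesgue measurable but need not be Borel measurable, so the density is taken with respect
   to the completed measure and the result is then restricted to the Borel sets. *)
definition law :: "('a::euclidean_space \<Rightarrow> real) \<Rightarrow> 'a measure" where
  "law p = distr (density lebesgue (\<lambda>x. ennreal (p x))) borel (\<lambda>x. x)"

(* Samples of size n are functions on {..<n}, i.e. observations are indexed from 0. *)
definition sample_law :: "nat \<Rightarrow> ('a::euclidean_space \<Rightarrow> real) \<Rightarrow> (nat \<Rightarrow> 'a) measure" where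
  "sample_law n p = PiM {..<n} (\<lambda>_. law p)"

definition H1_GOF ::
  "('a::euclidean_space \<Rightarrow> real) \<Rightarrow> real \<Rightarrow> real \<Rightarrow> real \<Rightarrow> ('a \<Rightarrow> real) set" where
  "H1_GOF p0 M s \<Delta> = {p. prob_density p \<and> p \<in> sobolev_ball s M \<and> L2_norm (\<lambda>x. p x - p0 x) \<ge> \<Delta>}"

(* A test is given by its rejection predicate on samples. *)
definition test_power ::
  "nat \<Rightarrow> ((nat \<Rightarrow> 'a) \<Rightarrow> bool) \<Rightarrow> ('a::euclidean_space \<Rightarrow> real) set \<Rightarrow> real" where
  "test_power n \<Phi> H = (if H = {} then 1 else
     (INF p\<in>H. measure (sample_law n p) {X \<in> space (sample_law n p). \<Phi> X}))"

definition gauss :: "real \<Rightarrow> 'a::euclidean_space \<Rightarrow> 'a \<Rightarrow> real" where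
  "gauss \<nu> x y = exp (- \<nu> * (norm (x - y))\<^sup>2)"

definition gauss_centered ::
  "('a::euclidean_space \<Rightarrow> real) \<Rightarrow> real \<Rightarrow> 'a \<Rightarrow> 'a \<Rightarrow> real" where
  "gauss_centered p0 \<nu> x y = gauss \<nu> x y
     - (LINT u|law p0. gauss \<nu> u y)
     - (LINT u|law p0. gauss \<nu> x u)
     + (LINT w|(law p0 \<Otimes>\<^sub>M law p0). gauss \<nu> (fst w) (snd w))"

definition gamma2_hat ::
  "('a::euclidean_space \<Rightarrow> real) \<Rightarrow> nat \<Rightarrow> real \<Rightarrow> (nat \<Rightarrow> 'a) \<Rightarrow> real" where
  "gamma2_hat p0 n \<nu> X = 1 / (real n * (real n - 1)) *
     (\<Sum>(i, j) \<in> {(i, j). i < n \<and> j < n \<and> i \<noteq> j}. gauss_centered p0 \<nu> (X i) (X j))"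

(* For n < 4 the truncated subtractions n - 3 and n - 4 are harmless: they only occur as
   coefficients of empty sums. *)
definition s2_tilde :: "nat \<Rightarrow> real \<Rightarrow> (nat \<Rightarrow> 'a::euclidean_space) \<Rightarrow> real" where
  "s2_tilde n \<nu> X =
     1 / (real n * (real n - 1)) *
       (\<Sum>(i, j) \<in> {(i, j). i < n \<and> j < n \<and> i \<noteq> j}. gauss (2 * \<nu>) (X i) (X j))
     - 2 * fact (n - 3) / fact n *
       (\<Sum>(i, j1, j2) \<in> {(i, j1, j2). i < n \<and> j1 < n \<and> j2 < n \<and> card {i, j1, j2} = 3}.
          gauss \<nu> (X i) (X j1) * gauss \<nu> (X i) (X j2))
     + fact (n - 4) / fact n *
       (\<Sum>(i1, i2, j1, j2) \<in> {(i1, i2, j1, j2). i1 < n \<and> i2 < n \<and> j1 < n \<and> j2 < n \<and>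
            card {i1, i2, j1, j2} = 4}.
          gauss \<nu> (X i1) (X j1) * gauss \<nu> (X i2) (X j2))"

definition s_hat :: "nat \<Rightarrow> real \<Rightarrow> (nat \<Rightarrow> 'a::euclidean_space) \<Rightarrow> real" where
  "s_hat n \<nu> X = sqrt (max (s2_tilde n \<nu> X) (1 / (real n)\<^sup>2))"

definition T_GOF ::
  "('a::euclidean_space \<Rightarrow> real) \<Rightarrow> nat \<Rightarrow> real \<Rightarrow> (nat \<Rightarrow> 'a) \<Rightarrow> real" where
  "T_GOF p0 n \<nu> X = real n / sqrt 2 * inverse (s_hat n \<nu> X) * gamma2_hat p0 n \<nu> X"

definition z_upper :: "real \<Rightarrow> real" where
  "z_upper \<alpha> = (THE z. measure (density lborel (\<lambda>x. ennreal (std_normal_density x))) {z<..} = \<alpha>)"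

definition Phi_GOF ::
  "('a::euclidean_space \<Rightarrow> real) \<Rightarrow> nat \<Rightarrow> real \<Rightarrow> real \<Rightarrow> (nat \<Rightarrow> 'a) \<Rightarrow> bool" where
  "Phi_GOF p0 n \<nu> \<alpha> X \<longleftrightarrow> T_GOF p0 n \<nu> X > z_upper \<alpha>"

(* Sequences start at n = 1: for n = 0 the rate 0 powr a is 0. *)
definition same_order :: "(nat \<Rightarrow> real) \<Rightarrow> (nat \<Rightarrow> real) \<Rightarrow> bool" where
  "same_order a b \<longleftrightarrow> (\<exists>c>0. \<exists>C>0. \<forall>n\<ge>1. c \<le> a n / b n \<and> a n / b n \<le> C)"

end

theory Submission
  imports Defs "HOL-Real_Asymp.Real_Asymp"
begin

text \<open>
Write f = p - p0, G = gauss \<nu>, D = DIM('a), F for the Fourier transform and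
K = \<integral> |F f|^2. Under the density p the estimator gamma2_hat has the mean
\<theta> = \<integral>\<integral> G(x,y) f(x) f(y), and the test rejects as soon as its numerator stays near \<theta> while
its random normalisation s_hat is small compared with n \<theta>. So the theorem follows from a lower
bound on \<theta> and upper bounds on three error terms that hold for all p in the Sobolev ball at once.

Up to the factor (pi/\<nu>)^(D/2), the form \<theta> is \<integral> exp(-|w|^2/(4\<nu>)) |F f(w)|^2
(gauss_form_fourier). The weight is at least exp(-1/4) for |w|^2 \<le> \<nu>, and by smoothness the
frequencies beyond that carry at most \<nu>^(-s) times the squared Sobolev norm. For large n the
choice of \<nu> makes this at most half of \<Delta>^2, so \<theta> is of order at least \<nu>^(-D/2) K. Moreover
K \<ge> \<integral> f^2 \<ge> \<Delta>^2. This half of Plancherel's theorem (L2_le_fourier_L2) is where continuity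
almost everywhere enters: Gaussian averages of f converge to f at its continuity points,
and the squares of their L2 norms are bounded by K because their Fourier transforms are damped copies of F f.

With \<phi> = G * f, the Hoeffding decomposition writes gamma2_hat - \<theta> as twice
the average of \<phi>(X_i) minus its mean, plus a U-statistic whose kernel k is degenerate, that is,
has mean zero in each argument. Both are sums of uncorrelated terms, so their variances are at most
of order E \<phi>^2 / n and E k^2 / n^2. Here E \<phi>^2 = \<integral> \<phi>^2 p is at most of order \<nu>^(-3D/4) K (gauss_conv_weighted_L2),
and E k^2 is at most a constant times e = \<integral>\<integral> G p p, which is at most of order \<nu>^(-D/2).
Dropping the negative part of s2_tilde and using 0 < G \<le> 1 bounds the mean of s_hat^2 by a constant
times e + 1/n^2. One application of Markov's inequality (rejection_probability_ge) then gives
a probability of non-rejection at most of order R + R^2 with R = \<nu>^(D/4) / (n \<Delta>^2).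
Since \<nu> is of order n^(4/(D+4s)), R is at most of order 1/(n^(2s/(D+4s)) \<Delta>)^2, which tends to 0.
\<close>

section \<open>Fourier transforms of Gaussians\<close>

text \<open>
The substitution x = y / sqrt (2 * a) turns the integral into the characteristic function of the
standard normal distribution.
\<close>

lemma gaussian_fourier_real:
  fixes a t :: real
  assumes "a > 0"
  shows "integrable lborel (\<lambda>x. complex_of_real (exp (- a * x\<^sup>2)) * iexp (t * x))"
    and "(LINT x|lborel. complex_of_real (exp (- a * x\<^sup>2)) * iexp (t * x)) =
      of_real (sqrt (pi / a) * exp (- t\<^sup>2 / (4 * a)))"
proof -
  define c where "c = 1 / sqrt (2 * a)"
  have c: "c > 0" "a * c\<^sup>2 = 1/2" using assms by (auto simp: c_def power_divide)
  have eq: "complex_of_real (exp (- a * (0 + c * x)\<^sup>2)) * iexp (t * (0 + c * x)) =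
     of_real (sqrt (2 * pi)) * (std_normal_density x *\<^sub>R iexp ((t * c) * x))" for x
  proof -
    have "- a * (0 + c * x)\<^sup>2 = - x\<^sup>2 / 2"
      using c(2) by (simp add: power_mult_distrib mult.assoc[symmetric])
    then show ?thesis unfolding std_normal_density_def scaleR_conv_of_real by (simp add: mult.assoc)
  qed
  have int1: "integrable lborel (\<lambda>x. std_normal_density x *\<^sub>R iexp ((t * c) * x))"
    by (rule Bochner_Integration.integrable_bound[OF integrable_normal_density[where \<mu>=0 and \<sigma>=1]]) auto
  have int2: "integrable lborel (\<lambda>x. complex_of_real (exp (- a * (0 + c * x)\<^sup>2)) * iexp (t * (0 + c * x)))"
    unfolding eq using int1 by (intro integrable_mult_right) auto
  show "integrable lborel (\<lambda>x. complex_of_real (exp (- a * x\<^sup>2)) * iexp (t * x))"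
    using int2 lborel_integrable_real_affine_iff[of c "\<lambda>x. complex_of_real (exp (- a * x\<^sup>2)) * iexp (t * x)" 0] c by simp
  have ch: "(LINT x|lborel. std_normal_density x *\<^sub>R iexp ((t * c) * x)) = of_real (exp (- ((t * c)\<^sup>2) / 2))"
    using fun_cong[OF char_std_normal_distribution, of "t * c"] unfolding char_def
    by (subst (asm) integral_density) auto
  have "(LINT x|lborel. complex_of_real (exp (- a * x\<^sup>2)) * iexp (t * x)) =
     \<bar>c\<bar> *\<^sub>R (of_real (sqrt (2 * pi)) * of_real (exp (- ((t * c)\<^sup>2) / 2)))"
    using c by (subst lborel_integral_real_affine[of c _ 0]) (auto simp only: eq ch integral_mult_right_zero)
  also have "(t * c)\<^sup>2 = t\<^sup>2 / (2 * a)" using assms by (simp add: c_def power_mult_distrib power_divide)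
  also have "\<bar>c\<bar> *\<^sub>R (of_real (sqrt (2 * pi)) * complex_of_real (exp (- (t\<^sup>2 / (2 * a)) / 2))) =
     of_real ((c * sqrt (2 * pi)) * exp (- t\<^sup>2 / (4 * a)))"
    using c by (simp add: scaleR_conv_of_real)
  also have "c * sqrt (2 * pi) = sqrt (pi / a)" unfolding c_def using assms by (simp add: real_sqrt_divide real_sqrt_mult field_simps)
  finally show "(LINT x|lborel. complex_of_real (exp (- a * x\<^sup>2)) * iexp (t * x)) =
      of_real (sqrt (pi / a) * exp (- t\<^sup>2 / (4 * a)))" .
qed

text \<open>
Lebesgue measure is a product over the standard basis and the integrand factorises accordingly.
\<close>

lemma gaussian_fourier:
  fixes w :: "'a::euclidean_space"
  assumes "a > 0"
  shows "integrable lborel (\<lambda>x. complex_of_real (exp (- a * (norm x)\<^sup>2)) * iexp (w \<bullet> x))" (is "integrable _ ?F")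
    and "(LINT x|lborel. complex_of_real (exp (- a * (norm x)\<^sup>2)) * iexp (w \<bullet> x)) =
      of_real ((pi / a) powr (real DIM('a) / 2) * exp (- (norm w)\<^sup>2 / (4 * a)))" (is ?eq)
proof -
  interpret product_sigma_finite "\<lambda>_::'a. lborel :: real measure" ..
  let ?f = "\<lambda>b y. complex_of_real (exp (- a * y\<^sup>2)) * iexp ((w \<bullet> b) * y)"
  have norm2: "(norm u)\<^sup>2 = (\<Sum>b\<in>Basis. (u \<bullet> b)\<^sup>2)" for u :: 'a
    unfolding power2_norm_eq_inner by (subst euclidean_inner) (simp add: power2_eq_square)
  have F: "?F (\<Sum>b\<in>Basis. f b *\<^sub>R b) = (\<Prod>b\<in>Basis. ?f b (f b))" for f
  proof -
    have "(\<Sum>b\<in>Basis. f b *\<^sub>R b) \<bullet> b = f b" if "b \<in> Basis" for b :: 'a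
      using that by (simp add: inner_sum_left inner_Basis if_distrib cong: if_cong)
    then have "(norm (\<Sum>b\<in>Basis. f b *\<^sub>R b))\<^sup>2 = (\<Sum>b\<in>Basis. (f b)\<^sup>2)" unfolding norm2 by simp
    moreover have "w \<bullet> (\<Sum>b\<in>Basis. f b *\<^sub>R b) = (\<Sum>b\<in>Basis. (w \<bullet> b) * f b)"
      by (simp add: inner_sum_right mult.commute)
    ultimately show ?thesis
      by (simp add: prod.distrib exp_sum sum_distrib_left sum_negf[symmetric] flip: of_real_prod)
  qed
  have m: "(\<lambda>f. \<Sum>b\<in>Basis. f b *\<^sub>R b) \<in> measurable (\<Pi>\<^sub>M b\<in>(Basis :: 'a set). lborel) borel" by measurable
  have intf: "integrable lborel (?f b)" for b using gaussian_fourier_real(1)[OF assms] .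
  have "integrable (\<Pi>\<^sub>M b\<in>(Basis :: 'a set). lborel) (\<lambda>f. ?F (\<Sum>b\<in>Basis. f b *\<^sub>R b))"
    unfolding F by (intro product_integrable_prod intf finite_Basis)
  then show "integrable lborel ?F"
    by (subst lborel_eq, subst integrable_distr_eq[OF m]) simp_all
  have "(LINT x|lborel. ?F x) = (\<integral>f. ?F (\<Sum>b\<in>Basis. f b *\<^sub>R b) \<partial>(\<Pi>\<^sub>M b\<in>(Basis :: 'a set). lborel))"
    by (subst lborel_eq, subst integral_distr[OF m]) auto
  also have "\<dots> = (\<Prod>b\<in>Basis. integral\<^sup>L lborel (?f b))"
    unfolding F by (intro product_integral_prod intf finite_Basis)
  also have "\<dots> = (\<Prod>b\<in>(Basis :: 'a set). of_real (sqrt (pi / a) * exp (- (w \<bullet> b)\<^sup>2 / (4 * a))))"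
    using gaussian_fourier_real(2)[OF assms] by simp
  also have "\<dots> = of_real (sqrt (pi / a) ^ DIM('a) * exp (- (norm w)\<^sup>2 / (4 * a)))"
    unfolding norm2 by (simp add: prod.distrib exp_sum sum_divide_distrib sum_negf[symmetric] flip: of_real_prod)
  also have "sqrt (pi / a) ^ DIM('a) = (pi / a) powr (real DIM('a) / 2)"
    using assms by (simp add: powr_half_sqrt[symmetric] powr_realpow[symmetric] powr_powr)
  finally show ?eq .
qed

section \<open>The Gaussian quadratic form in frequency space\<close>

lemma gauss_measurable [measurable]:
  "(\<lambda>z. gauss \<nu> (fst z) (snd z)) \<in> borel_measurable (borel \<Otimes>\<^sub>M borel)"
  unfolding gauss_def by (measurable)

lemma gauss_commute: "gauss \<nu> x y = gauss \<nu> y x"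
  by (simp add: gauss_def norm_minus_commute)

lemma gauss_pos: "0 < gauss \<nu> x y"
  by (simp add: gauss_def)

lemma gauss_le_1: "0 \<le> \<nu> \<Longrightarrow> gauss \<nu> x y \<le> 1"
  by (simp add: gauss_def)

lemma integrable_gauss: "\<nu> > 0 \<Longrightarrow> integrable lborel (\<lambda>x::'a::euclidean_space. gauss \<nu> x y)"
  and integral_gauss: "\<nu> > 0 \<Longrightarrow> (LINT x|lborel. gauss \<nu> x (y::'a)) = (pi / \<nu>) powr (real DIM('a) / 2)"
proof -
  assume \<nu>: "\<nu> > 0"
  have *: "has_bochner_integral lborel (\<lambda>x::'a. exp (- \<nu> * (norm x)\<^sup>2)) ((pi / \<nu>) powr (real DIM('a) / 2))"
    using gaussian_fourier[OF \<nu>, of "0::'a"] integrable_Re[OF gaussian_fourier(1)[OF \<nu>, of "0::'a"]]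
    by (simp add: has_bochner_integral_iff)
  have "has_bochner_integral (distr lborel borel ((+) y)) (\<lambda>x::'a. gauss \<nu> x y) ((pi / \<nu>) powr (real DIM('a) / 2))"
    unfolding gauss_def using * by (intro has_bochner_integral_distr) simp_all
  then have "has_bochner_integral lborel (\<lambda>x::'a. gauss \<nu> x y) ((pi / \<nu>) powr (real DIM('a) / 2))"
    unfolding lborel_distr_plus .
  then show "integrable lborel (\<lambda>x::'a. gauss \<nu> x y)" "(LINT x|lborel. gauss \<nu> x (y::'a)) = (pi / \<nu>) powr (real DIM('a) / 2)"
    by (auto simp: has_bochner_integral_iff)
qed

text \<open>
A Gaussian is, up to scaling, its own Fourier transform. Read as a superposition of characters
in x - y, the kernel is visibly positive definite.
\<close>

lemma gauss_fourier_inversion: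
  fixes x y :: "'a::euclidean_space"
  assumes "\<nu> > 0"
  shows "complex_of_real (gauss \<nu> x y) = of_real ((4 * pi * \<nu>) powr (- real DIM('a) / 2)) *
     (LINT w|lborel. complex_of_real (exp (- (norm w)\<^sup>2 / (4 * \<nu>))) * iexp ((x - y) \<bullet> w))"
proof -
  have "(LINT w|lborel. complex_of_real (exp (- (norm w)\<^sup>2 / (4 * \<nu>))) * iexp ((x - y) \<bullet> w)) =
      of_real ((4 * pi * \<nu>) powr (real DIM('a) / 2) * gauss \<nu> x y)"
    using gaussian_fourier(2)[of "1 / (4 * \<nu>)" "x - y"] assms
    by (simp add: gauss_def field_simps)
  then show ?thesis using assms by (simp add: powr_minus field_simps powr_gt_zero)
qed

lemma (in pair_sigma_finite) integrable_tensor: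
  fixes f g :: "_ \<Rightarrow> _ :: {banach, second_countable_topology, real_normed_field}"
  assumes "integrable M1 f" "integrable M2 g"
  shows "integrable (M1 \<Otimes>\<^sub>M M2) (\<lambda>z. f (fst z) * g (snd z))"
proof (rule Fubini_integrable)
  have [measurable]: "f \<in> borel_measurable M1" "g \<in> borel_measurable M2" using assms by auto
  show "(\<lambda>z. f (fst z) * g (snd z)) \<in> borel_measurable (M1 \<Otimes>\<^sub>M M2)" by measurable
  show "integrable M1 (\<lambda>x. \<integral> y. norm (f (fst (x, y)) * g (snd (x, y))) \<partial>M2)"
    using assms by (simp add: norm_mult)
  show "AE x in M1. integrable M2 (\<lambda>y. f (fst (x, y)) * g (snd (x, y)))"
    using assms by simp
qed

lemma fourier_borel:
  assumes [measurable]: "f \<in> borel_measurable borel"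
  shows "fourier f w = of_real ((2 * pi) powr (- real DIM('a) / 2)) *
     (LINT x|lborel. of_real (f x) * iexp (- (w \<bullet> (x::'a::euclidean_space))))"
proof -
  have "(LINT x|lebesgue. of_real (f x) * exp (- (\<i> * of_real (x \<bullet> w)))) = (LINT x|lborel. of_real (f x) * exp (- (\<i> * complex_of_real (x \<bullet> w))))"
    by (intro integral_completion) measurable
  then show ?thesis by (simp add: fourier_def inner_commute)
qed

lemma fourier_measurable:
  assumes [measurable]: "f \<in> borel_measurable borel"
  shows "fourier f \<in> borel_measurable (borel :: 'a::euclidean_space measure)"
proof -
  have [measurable]: "f \<in> borel_measurable lborel" by simp
  have "fourier f = (\<lambda>w. of_real ((2 * pi) powr (- real DIM('a) / 2)) *
     (LINT x|lborel. of_real (f x) * iexp (- (w \<bullet> (x::'a::euclidean_space)))))"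
    using fourier_borel[OF assms] by auto
  also have "\<dots> \<in> borel_measurable borel" by measurable
  finally show ?thesis .
qed

lemma integrable_gaussian_weight:
  "\<nu> > 0 \<Longrightarrow> integrable lborel (\<lambda>w::'a::euclidean_space. exp (- (norm w)\<^sup>2 / (4 * \<nu>)))"
  using integrable_gauss[of "1 / (4 * \<nu>)" "0::'a"] by (simp add: gauss_def)

lemma integrable_gauss_tensor:
  fixes f g :: "'a::euclidean_space \<Rightarrow> real"
  assumes "integrable lborel f" "integrable lborel g" "0 \<le> \<nu>"
  shows "integrable (lborel \<Otimes>\<^sub>M lborel) (\<lambda>z. gauss \<nu> (fst z) (snd z) * (f (fst z) * g (snd z)))"
proof (rule Bochner_Integration.integrable_bound[OF lborel_pair.integrable_tensor[OF assms(1,2)]])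
  have [measurable]: "f \<in> borel_measurable borel" "g \<in> borel_measurable borel" using assms by auto
  have [measurable]: "(\<lambda>z::'a\<times>'a. gauss \<nu> (fst z) (snd z)) \<in> borel_measurable (lborel \<Otimes>\<^sub>M lborel)"
    using gauss_measurable[of \<nu>] by (simp add: borel_prod lborel_prod)
  show "(\<lambda>z. gauss \<nu> (fst z) (snd z) * (f (fst z) * g (snd z))) \<in> borel_measurable (lborel \<Otimes>\<^sub>M lborel)"
    by measurable
  have "norm (gauss \<nu> (fst z) (snd z) * (f (fst z) * g (snd z))) \<le> norm (f (fst z) * g (snd z))" for z :: "'a \<times> 'a"
    using mult_right_mono[OF gauss_le_1[OF assms(3), of "fst z" "snd z"], of "\<bar>f (fst z) * g (snd z)\<bar>"] gauss_pos[of \<nu> "fst z" "snd z"]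
    by (simp add: abs_mult)
  then show "AE z in lborel \<Otimes>\<^sub>M lborel. norm (gauss \<nu> (fst z) (snd z) * (f (fst z) * g (snd z))) \<le> norm (f (fst z) * g (snd z))"
    by simp
qed

text \<open>
Insert the superposition of characters for the kernel and exchange the integrals: for each frequency w
the double integral over (x, y) is a product of an integral and its complex conjugate.
\<close>

lemma gauss_form_fourier:
  fixes f :: "'a::euclidean_space \<Rightarrow> real"
  assumes f [measurable]: "f \<in> borel_measurable borel" and intf: "integrable lborel f" and \<nu>: "\<nu> > 0"
  shows "(LINT z|(lborel \<Otimes>\<^sub>M lborel). gauss \<nu> (fst z) (snd z) * (f (fst z) * f (snd z))) =
     (pi / \<nu>) powr (real DIM('a) / 2) * (LINT w|lborel. exp (- (norm w)\<^sup>2 / (4 * \<nu>)) * (cmod (fourier f w))\<^sup>2)"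
    (is "?L = ?R")
proof -
  let ?N = "lborel :: ('a \<times> 'a) measure"
  let ?g = "\<lambda>w::'a. complex_of_real (exp (- (norm w)\<^sup>2 / (4 * \<nu>)))"
  let ?F = "\<lambda>z::'a\<times>'a. complex_of_real (f (fst z) * f (snd z))"
  let ?H = "\<lambda>w z::'a\<times>'a. ?g w * ?F z * iexp ((fst z - snd z) \<bullet> w)"
  let ?c = "complex_of_real ((4 * pi * \<nu>) powr (- real DIM('a) / 2))"
  let ?d = "(2 * pi) powr (real DIM('a) / 2)"
  have [measurable]: "fst \<in> borel_measurable ?N" "snd \<in> borel_measurable ?N"
    by (auto simp: lborel_prod[symmetric])
  have gm [measurable]: "(\<lambda>z. gauss \<nu> (fst z) (snd z)) \<in> borel_measurable ?N"
    using gauss_measurable[of \<nu>] by (simp add: borel_prod)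
  have intF: "integrable ?N ?F"
    using lborel_pair.integrable_tensor[OF intf intf] by (simp add: lborel_prod flip: of_real_mult)
  have intg: "integrable lborel ?g"
    using integrable_gaussian_weight[OF \<nu>] by (rule integrable_of_real)
  have intH: "integrable (lborel \<Otimes>\<^sub>M ?N) (case_prod ?H)"
    by (rule Bochner_Integration.integrable_bound[OF lborel_pair.integrable_tensor[OF intg intF]])
      (auto simp: norm_mult split_beta)
  have inner: "(LINT z|?N. ?H w z) = of_real (?d\<^sup>2 * (exp (- (norm w)\<^sup>2 / (4 * \<nu>)) * (cmod (fourier f w))\<^sup>2))" for w
  proof -
    let ?u = "\<lambda>x. complex_of_real (f x) * iexp (w \<bullet> x)"
    let ?v = "\<lambda>x. complex_of_real (f x) * iexp (- (w \<bullet> x))"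
    have intu: "integrable lborel ?u" "integrable lborel ?v"
      by (rule Bochner_Integration.integrable_bound[OF intf]; simp add: norm_mult)+
    have v: "integral\<^sup>L lborel ?v = of_real ?d * fourier f w"
      unfolding fourier_borel[OF f] by (simp add: powr_minus field_simps flip: of_real_mult)
    have "integral\<^sup>L lborel ?u = cnj (integral\<^sup>L lborel ?v)"
    proof -
      have "?u x = cnj (?v x)" for x by (simp add: exp_cnj)
      then show ?thesis by (simp only: Bochner_Integration.integral_cnj)
    qed
    then have u: "integral\<^sup>L lborel ?u = of_real ?d * cnj (fourier f w)" unfolding v by simp
    have "(LINT z|?N. ?H w z) = ?g w * (LINT z|?N. ?u (fst z) * ?v (snd z))"
      unfolding integral_mult_right_zero[symmetric]
      by (intro Bochner_Integration.integral_cong) (auto simp: inner_diff_left inner_diff_right exp_diff exp_minus inner_commute field_simps)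
    also have "(LINT z|?N. ?u (fst z) * ?v (snd z)) = (LINT x|lborel. LINT y|lborel. ?u x * ?v y)"
      using lborel_pair.integral_fst'[OF lborel_pair.integrable_tensor[OF intu]] by (simp add: lborel_prod)
    also have "\<dots> = integral\<^sup>L lborel ?u * integral\<^sup>L lborel ?v" by simp
    also have "\<dots> = of_real (?d\<^sup>2) * of_real ((cmod (fourier f w))\<^sup>2)"
      unfolding u v complex_norm_square by (simp add: power2_eq_square)
    finally show ?thesis by simp
  qed
  have "complex_of_real ?L = (LINT z|?N. ?F z * of_real (gauss \<nu> (fst z) (snd z)))"
    by (simp add: lborel_prod mult.commute flip: integral_complex_of_real of_real_mult)
  also have "\<dots> = (LINT z|?N. ?c * (LINT w|lborel. ?H w z))"
    unfolding gauss_fourier_inversion[OF \<nu>] by (simp add: integral_mult_right_zero[symmetric] ac_simps del: integral_mult_right_zero)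
  also have "\<dots> = ?c * (LINT z|?N. LINT w|lborel. ?H w z)" by simp
  also have "(LINT z|?N. LINT w|lborel. ?H w z) = (LINT w|lborel. LINT z|?N. ?H w z)"
    by (rule lborel_pair.Fubini_integral[OF intH])
  also have "\<dots> = of_real (?d\<^sup>2 * (LINT w|lborel. exp (- (norm w)\<^sup>2 / (4 * \<nu>)) * (cmod (fourier f w))\<^sup>2))"
    by (simp only: inner integral_complex_of_real integral_mult_right_zero)
  finally have "?L = (4 * pi * \<nu>) powr (- real DIM('a) / 2) * ?d\<^sup>2 * (LINT w|lborel. exp (- (norm w)\<^sup>2 / (4 * \<nu>)) * (cmod (fourier f w))\<^sup>2)"
    by (simp add: mult.assoc flip: of_real_mult)
  also have "(4 * pi * \<nu>) powr (- real DIM('a) / 2) * ?d\<^sup>2 = (pi / \<nu>) powr (real DIM('a) / 2)"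
  proof -
    have "?d\<^sup>2 = ((2 * pi)\<^sup>2) powr (real DIM('a) / 2)"
      unfolding power2_eq_square by (rule powr_mult[symmetric])
    moreover have "(4 * pi * \<nu>) powr (- real DIM('a) / 2) = inverse (4 * pi * \<nu>) powr (real DIM('a) / 2)"
      using \<nu> by (subst inverse_powr) (simp_all add: powr_minus)
    ultimately have "(4 * pi * \<nu>) powr (- real DIM('a) / 2) * ?d\<^sup>2 =
        inverse (4 * pi * \<nu>) powr (real DIM('a) / 2) * ((2 * pi)\<^sup>2) powr (real DIM('a) / 2)" by simp
    also have "\<dots> = (inverse (4 * pi * \<nu>) * (2 * pi)\<^sup>2) powr (real DIM('a) / 2)" by (rule powr_mult[symmetric])
    also have "inverse (4 * pi * \<nu>) * (2 * pi)\<^sup>2 = pi / \<nu>" using \<nu> by (simp add: field_simps power2_eq_square)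
    finally show ?thesis .
  qed
  finally show ?thesis .
qed

section \<open>Gaussian smoothing and Plancherel's inequality\<close>

lemma Cauchy_Schwarz_integral:
  fixes f g :: "'b \<Rightarrow> real"
  assumes [measurable]: "f \<in> borel_measurable M" "g \<in> borel_measurable M"
    and f: "integrable M (\<lambda>x. (f x)\<^sup>2)" and g: "integrable M (\<lambda>x. (g x)\<^sup>2)"
  shows "integrable M (\<lambda>x. f x * g x)"
    and "(LINT x|M. f x * g x)\<^sup>2 \<le> (LINT x|M. (f x)\<^sup>2) * (LINT x|M. (g x)\<^sup>2)"
proof -
  show int: "integrable M (\<lambda>x. f x * g x)"
  proof (rule Bochner_Integration.integrable_bound[OF Bochner_Integration.integrable_add[OF f g]])
    have "\<bar>a * b\<bar> \<le> a\<^sup>2 + b\<^sup>2" for a b :: real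
    proof -
      have "2 * (\<bar>a\<bar> * \<bar>b\<bar>) \<le> a\<^sup>2 + b\<^sup>2" using sum_squares_bound[of "\<bar>a\<bar>" "\<bar>b\<bar>"] by simp
      moreover have "0 \<le> \<bar>a\<bar> * \<bar>b\<bar>" by simp
      ultimately show ?thesis unfolding abs_mult by linarith
    qed
    then show "AE x in M. norm (f x * g x) \<le> norm ((f x)\<^sup>2 + (g x)\<^sup>2)" by simp
  qed measurable
  have int': "integrable M (\<lambda>x. \<bar>f x\<bar> * \<bar>g x\<bar>)" using integrable_abs[OF int] by (simp add: abs_mult)
  have "(LINT x|M. f x * g x)\<^sup>2 \<le> (LINT x|M. \<bar>f x\<bar> * \<bar>g x\<bar>)\<^sup>2"
    using integral_abs_bound[of M "\<lambda>x. f x * g x"] by (simp add: abs_mult abs_le_square_iff[symmetric])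
  also have "\<dots> \<le> (LINT x|M. (f x)\<^sup>2) * (LINT x|M. (g x)\<^sup>2)"
  proof -
    have "(\<integral>\<^sup>+x. ennreal \<bar>f x\<bar> * ennreal \<bar>g x\<bar> \<partial>M)\<^sup>2 \<le> (\<integral>\<^sup>+x. (ennreal \<bar>f x\<bar>)\<^sup>2 \<partial>M) * (\<integral>\<^sup>+x. (ennreal \<bar>g x\<bar>)\<^sup>2 \<partial>M)"
      by (rule Cauchy_Schwarz_nn_integral) measurable
    also have "(\<integral>\<^sup>+x. ennreal \<bar>f x\<bar> * ennreal \<bar>g x\<bar> \<partial>M) = ennreal (LINT x|M. \<bar>f x\<bar> * \<bar>g x\<bar>)"
      using nn_integral_eq_integral[OF int'] by (simp add: ennreal_mult)
    also have "(\<integral>\<^sup>+x. (ennreal \<bar>f x\<bar>)\<^sup>2 \<partial>M) = ennreal (LINT x|M. (f x)\<^sup>2)"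
      using nn_integral_eq_integral[OF f] by (simp add: ennreal_power)
    also have "(\<integral>\<^sup>+x. (ennreal \<bar>g x\<bar>)\<^sup>2 \<partial>M) = ennreal (LINT x|M. (g x)\<^sup>2)"
      using nn_integral_eq_integral[OF g] by (simp add: ennreal_power)
    finally show ?thesis by (simp add: ennreal_power flip: ennreal_mult)
  qed
  finally show "(LINT x|M. f x * g x)\<^sup>2 \<le> (LINT x|M. (f x)\<^sup>2) * (LINT x|M. (g x)\<^sup>2)" .
qed

text \<open>
The parallelogram law, exponentiated. Integrating out u shows that the product of two Gaussian
smoothing operators is again one; this is what makes the L2 norm of a smoothed function a Gaussian form.
\<close>

lemma gauss_mult:
  fixes x y u :: "'a::euclidean_space"
  shows "gauss \<nu> u x * gauss \<nu> u y = gauss (2 * \<nu>) u ((1/2) *\<^sub>R (x + y)) * gauss (\<nu> / 2) x y"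
proof -
  have "(norm (u - x))\<^sup>2 + (norm (u - y))\<^sup>2 = 2 * (norm (u - (1/2) *\<^sub>R (x + y)))\<^sup>2 + (1/2) * (norm (x - y))\<^sup>2"
    unfolding power2_norm_eq_inner by (simp add: algebra_simps inner_commute)
  from arg_cong[OF this, of "(*) (- \<nu>)"]
  have "- \<nu> * (norm (u - x))\<^sup>2 + - \<nu> * (norm (u - y))\<^sup>2 = - (2 * \<nu>) * (norm (u - (1/2) *\<^sub>R (x + y)))\<^sup>2 + - (\<nu> / 2) * (norm (x - y))\<^sup>2"
    unfolding distrib_left by simp
  then show ?thesis unfolding gauss_def by (simp only: exp_add[symmetric])
qed

definition gauss_conv :: "real \<Rightarrow> ('a::euclidean_space \<Rightarrow> real) \<Rightarrow> 'a \<Rightarrow> real" where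
  "gauss_conv \<nu> f x = (LINT y|lborel. gauss \<nu> x y * f y)"

lemma gauss_measurable1 [measurable]: "gauss \<nu> x \<in> borel_measurable borel"
  unfolding gauss_def by measurable

lemma gauss_measurable2 [measurable (raw)]:
  assumes "f \<in> borel_measurable M" "g \<in> borel_measurable M"
  shows "(\<lambda>z. gauss \<nu> (f z) (g z)) \<in> borel_measurable M"
  using assms unfolding gauss_def by measurable

lemma integrable_gauss_mult:
  fixes f :: "'a::euclidean_space \<Rightarrow> real"
  assumes "integrable lborel f" "0 \<le> \<nu>"
  shows "integrable lborel (\<lambda>y. gauss \<nu> x y * f y)"
proof (rule Bochner_Integration.integrable_bound[OF assms(1)])
  have [measurable]: "f \<in> borel_measurable borel" using assms by auto
  show "(\<lambda>y. gauss \<nu> x y * f y) \<in> borel_measurable lborel" by measurable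
  show "AE y in lborel. norm (gauss \<nu> x y * f y) \<le> norm (f y)"
    using gauss_le_1[OF assms(2), of x] gauss_pos[of \<nu> x, THEN less_imp_le] by (auto simp: abs_mult intro!: mult_left_le_one_le)
qed

lemma gauss_conv_measurable [measurable]:
  assumes [measurable]: "f \<in> borel_measurable borel"
  shows "gauss_conv \<nu> f \<in> borel_measurable (borel :: 'a::euclidean_space measure)"
proof -
  have [measurable]: "f \<in> borel_measurable lborel" by simp
  show ?thesis unfolding gauss_conv_def[abs_def] by measurable
qed

lemma gauss_conv_L2:
  fixes f :: "'a::euclidean_space \<Rightarrow> real"
  assumes f [measurable]: "f \<in> borel_measurable borel" and intf: "integrable lborel f" and \<nu>: "\<nu> > 0"
  shows "integrable lborel (\<lambda>u. (gauss_conv \<nu> f u)\<^sup>2)"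
    and "(LINT u|lborel. (gauss_conv \<nu> f u)\<^sup>2) =
      (pi / \<nu>) powr real DIM('a) * (LINT w|lborel. exp (- (norm w)\<^sup>2 / (2 * \<nu>)) * (cmod (fourier f w))\<^sup>2)"
proof -
  let ?N = "lborel :: ('a \<times> 'a) measure"
  have [measurable]: "fst \<in> borel_measurable ?N" "snd \<in> borel_measurable ?N"
    by (auto simp: lborel_prod[symmetric])
  let ?H = "\<lambda>z u. gauss \<nu> u (fst z) * f (fst z) * (gauss \<nu> u (snd z) * f (snd z))"
  have H: "?H z u = gauss (2 * \<nu>) u ((1/2) *\<^sub>R (fst z + snd z)) * (gauss (\<nu>/2) (fst z) (snd z) * (f (fst z) * f (snd z)))" for z u
    using gauss_mult[of \<nu> u "fst z" "snd z"] by (simp add: ac_simps)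
  let ?c = "(pi / (2 * \<nu>)) powr (real DIM('a) / 2)"
  have 2: "2 * \<nu> > 0" and h: "\<nu> / 2 > 0" using \<nu> by auto
  have gabs: "\<bar>gauss \<mu> x y\<bar> = gauss \<mu> x y" for \<mu> and x y :: 'a
    using gauss_pos[of \<mu> x y] by simp
  have inner: "integrable lborel (?H z)" "(LINT u|lborel. ?H z u) = ?c * (gauss (\<nu>/2) (fst z) (snd z) * (f (fst z) * f (snd z)))"
     "(LINT u|lborel. norm (?H z u)) = ?c * norm (gauss (\<nu>/2) (fst z) (snd z) * (f (fst z) * f (snd z)))" for z
    unfolding H norm_mult using integrable_gauss[OF 2, where 'a='a] integral_gauss[OF 2, where 'a='a]
    by (simp_all add: gabs)
  have intT: "integrable ?N (\<lambda>z. gauss (\<nu>/2) (fst z) (snd z) * (f (fst z) * f (snd z)))"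
    using integrable_gauss_tensor[OF intf intf, of "\<nu> / 2"] \<nu> by (simp add: lborel_prod)
  have intH: "integrable (?N \<Otimes>\<^sub>M lborel) (\<lambda>(z, u). ?H z u)"
  proof (rule lborel_pair.Fubini_integrable)
    show "(\<lambda>(z, u). ?H z u) \<in> borel_measurable (?N \<Otimes>\<^sub>M lborel)" unfolding split_beta by measurable
    show "integrable ?N (\<lambda>z. LINT u|lborel. norm (case (z, u) of (z, u) \<Rightarrow> ?H z u))"
      using integrable_norm[OF intT] by (simp only: prod.case inner(3)) (rule integrable_mult_right, simp)
    show "AE z in ?N. integrable lborel (\<lambda>u. case (z, u) of (z, u) \<Rightarrow> ?H z u)"
      using inner(1) by simp
  qed
  \<comment> \<open>For fixed u the integrand factorises in the two components of z.\<close>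
  have sq: "(LINT z|?N. ?H z u) = (gauss_conv \<nu> f u)\<^sup>2" for u
  proof -
    have i: "integrable lborel (\<lambda>y. gauss \<nu> u y * f y)" using integrable_gauss_mult[OF intf] \<nu> by simp
    show ?thesis
      using lborel_pair.integral_fst'[OF lborel_pair.integrable_tensor[OF i i]]
      by (simp add: lborel_prod gauss_conv_def power2_eq_square)
  qed
  show "integrable lborel (\<lambda>u. (gauss_conv \<nu> f u)\<^sup>2)"
    using lborel_pair.integrable_snd[OF intH] unfolding sq .
  have "(LINT u|lborel. (gauss_conv \<nu> f u)\<^sup>2) = (LINT z|?N. LINT u|lborel. ?H z u)"
    using lborel_pair.Fubini_integral[OF intH] unfolding sq .
  also have "\<dots> = ?c * (LINT z|(lborel \<Otimes>\<^sub>M lborel). gauss (\<nu>/2) (fst z) (snd z) * (f (fst z) * f (snd z)))"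
    unfolding inner(2) by (simp add: lborel_prod)
  also have "\<dots> = ?c * (pi / (\<nu> / 2)) powr (real DIM('a) / 2) * (LINT w|lborel. exp (- (norm w)\<^sup>2 / (4 * (\<nu> / 2))) * (cmod (fourier f w))\<^sup>2)"
    unfolding gauss_form_fourier[OF f intf h] by simp
  also have "?c * (pi / (\<nu> / 2)) powr (real DIM('a) / 2) = (pi / \<nu>) powr real DIM('a)"
  proof -
    have "?c * (pi / (\<nu> / 2)) powr (real DIM('a) / 2) = ((pi / (2 * \<nu>)) * (pi / (\<nu> / 2))) powr (real DIM('a) / 2)"
      by (rule powr_mult[symmetric])
    also have "(pi / (2 * \<nu>)) * (pi / (\<nu> / 2)) = (pi / \<nu>) powr 2"
      using \<nu> by (simp add: power2_eq_square)
    finally show ?thesis by (simp add: powr_powr)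
  qed
  finally show "(LINT u|lborel. (gauss_conv \<nu> f u)\<^sup>2) =
      (pi / \<nu>) powr real DIM('a) * (LINT w|lborel. exp (- (norm w)\<^sup>2 / (2 * \<nu>)) * (cmod (fourier f w))\<^sup>2)"
    by simp
qed

lemma gauss_conv_L2_le:
  fixes f :: "'a::euclidean_space \<Rightarrow> real"
  assumes f [measurable]: "f \<in> borel_measurable borel" and intf: "integrable lborel f" and \<nu>: "\<nu> > 0"
    and K: "integrable lborel (\<lambda>w. (cmod (fourier f w))\<^sup>2)"
  shows "(LINT u|lborel. (gauss_conv \<nu> f u)\<^sup>2) \<le> (pi / \<nu>) powr real DIM('a) * (LINT w|lborel. (cmod (fourier f w))\<^sup>2)"
proof -
  note [measurable] = fourier_measurable[OF f]
  have le: "exp (- (norm w)\<^sup>2 / (2 * \<nu>)) * (cmod (fourier f w))\<^sup>2 \<le> (cmod (fourier f w))\<^sup>2" for w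
    using \<nu> by (intro mult_left_le_one_le) auto
  have "integrable lborel (\<lambda>w. exp (- (norm w)\<^sup>2 / (2 * \<nu>)) * (cmod (fourier f w))\<^sup>2)"
    by (rule Bochner_Integration.integrable_bound[OF K]) (use le in \<open>auto simp: abs_mult\<close>)
  then show ?thesis unfolding gauss_conv_L2(2)[OF f intf \<nu>]
    using le K by (intro mult_left_mono integral_mono) auto
qed

lemma powr_exp_decay:
  fixes c D :: real
  assumes "c > 0"
  shows "((\<lambda>\<nu>. (\<nu> / pi) powr D * exp (- (\<nu> * c))) \<longlongrightarrow> 0) at_top"
    and "((\<lambda>\<nu>. exp (- (\<nu> * c / 2))) \<longlongrightarrow> 0) at_top"
  using assms by real_asymp+

text \<open>
The function h may be badly behaved on a null set, so the average is taken of the Borel version f while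
continuity is that of h. Near x, continuity makes the difference small. At distance at least \<delta> the
kernel is itself exponentially small in \<nu>, which deals with the integrable function f; against the constant h x
it is split as the square of the kernel with parameter \<nu> / 2, one factor being small and the other integrable.
\<close>

lemma gauss_conv_approximate_identity:
  fixes f h :: "'a::euclidean_space \<Rightarrow> real"
  assumes f [measurable]: "f \<in> borel_measurable borel" and intf: "integrable lborel f"
    and ae: "AE y in lborel. h y = f y" and cont: "isCont h x"
  shows "((\<lambda>\<nu>. (\<nu> / pi) powr (real DIM('a) / 2) * gauss_conv \<nu> f x) \<longlongrightarrow> h x) at_top"
proof (rule tendstoI)
  fix e :: real assume "e > 0"
  define D where "D = real DIM('a) / 2"
  obtain \<delta> where \<delta>: "\<delta> > 0" "\<And>y. dist y x < \<delta> \<Longrightarrow> dist (h y) (h x) < e / 2"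
    using cont \<open>e > 0\<close> unfolding continuous_at_eps_delta by (metis half_gt_zero)
  define A where "A = (LINT y|lborel. \<bar>f y\<bar>)"
  define B where "B \<nu> = e / 2 + (\<nu> / pi) powr D * exp (- (\<nu> * \<delta>\<^sup>2)) * A + exp (- (\<nu> * \<delta>\<^sup>2 / 2)) * 2 powr D * \<bar>h x\<bar>" for \<nu>
  have "((\<lambda>\<nu>. (\<nu> / pi) powr D * exp (- (\<nu> * \<delta>\<^sup>2))) \<longlongrightarrow> 0) at_top"
    "((\<lambda>\<nu>. exp (- (\<nu> * \<delta>\<^sup>2 / 2))) \<longlongrightarrow> 0) at_top"
    using \<open>\<delta> > 0\<close> by (intro powr_exp_decay; simp)+
  then have "(B \<longlongrightarrow> e / 2 + 0 * A + 0 * 2 powr D * \<bar>h x\<bar>) at_top"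
    unfolding B_def[abs_def] by (intro tendsto_intros)
  then have evB: "eventually (\<lambda>\<nu>. B \<nu> < e) at_top"
    using \<open>e > 0\<close> by (rule_tac order_tendstoD(2)[where y="e / 2"]) simp_all
  show "\<forall>\<^sub>F \<nu> in at_top. dist ((\<nu> / pi) powr (real DIM('a) / 2) * gauss_conv \<nu> f x) (h x) < e"
    using evB eventually_gt_at_top[of 0]
  proof eventually_elim
    case (elim \<nu>)
    let ?c = "(\<nu> / pi) powr D"
    have c: "?c > 0" "?c * (pi / \<nu>) powr D = 1"
      using elim by (auto simp: powr_mult[symmetric])
    have 2: "?c * (pi / (\<nu> / 2)) powr D = 2 powr D"
      using elim by (simp add: powr_mult[symmetric])
    have ig: "integrable lborel (\<lambda>y. gauss \<nu> x y)" "(LINT y|lborel. gauss \<nu> x y) = (pi / \<nu>) powr D"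
      using integrable_gauss[of \<nu> x] integral_gauss[of \<nu> x] elim by (auto simp: gauss_commute[of \<nu> x] D_def)
    have ig2: "integrable lborel (\<lambda>y. gauss (\<nu>/2) x y)" "(LINT y|lborel. gauss (\<nu>/2) x y) = (pi / (\<nu> / 2)) powr D"
      using integrable_gauss[of "\<nu>/2" x] integral_gauss[of "\<nu>/2" x] elim by (auto simp: gauss_commute[of "\<nu>/2" x] D_def)
    let ?R = "\<lambda>y. gauss \<nu> x y * (e / 2) + exp (- (\<nu> * \<delta>\<^sup>2)) * \<bar>f y\<bar> + gauss (\<nu>/2) x y * (exp (- (\<nu> * \<delta>\<^sup>2 / 2)) * \<bar>h x\<bar>)"
    have bound: "\<bar>gauss \<nu> x y * (f y - h x)\<bar> \<le> ?R y" if "h y = f y" for y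
    proof (cases "dist y x < \<delta>")
      case True
      have "\<bar>gauss \<nu> x y * (f y - h x)\<bar> \<le> gauss \<nu> x y * (e / 2)"
        using \<delta>(2)[OF True] that gauss_pos[of \<nu> x y] by (auto simp: abs_mult dist_real_def intro!: mult_left_mono)
      moreover have "0 \<le> exp (- (\<nu> * \<delta>\<^sup>2)) * \<bar>f y\<bar>" "0 \<le> gauss (\<nu>/2) x y * (exp (- (\<nu> * \<delta>\<^sup>2 / 2)) * \<bar>h x\<bar>)"
        using gauss_pos[of "\<nu>/2" x y] by simp_all
      ultimately show ?thesis by linarith
    next
      case False
      then have n: "\<delta>\<^sup>2 \<le> (norm (x - y))\<^sup>2" using \<open>\<delta> > 0\<close> by (intro power_mono) (auto simp: dist_norm norm_minus_commute)
      have g1: "gauss \<nu> x y \<le> exp (- (\<nu> * \<delta>\<^sup>2))"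
        using n elim by (simp add: gauss_def)
      have g3: "gauss (\<nu>/2) x y \<le> exp (- (\<nu> * \<delta>\<^sup>2 / 2))"
        using n elim by (simp add: gauss_def)
      have "gauss \<nu> x y = gauss (\<nu>/2) x y * gauss (\<nu>/2) x y"
        by (simp add: gauss_def exp_add[symmetric])
      then have g2: "gauss \<nu> x y \<le> gauss (\<nu>/2) x y * exp (- (\<nu> * \<delta>\<^sup>2 / 2))"
        using g3 gauss_pos[of "\<nu>/2" x y] by simp
      have "\<bar>gauss \<nu> x y * (f y - h x)\<bar> \<le> gauss \<nu> x y * \<bar>f y\<bar> + gauss \<nu> x y * \<bar>h x\<bar>"
        using mult_left_mono[OF abs_triangle_ineq4[of "f y" "h x"], of "gauss \<nu> x y"] gauss_pos[of \<nu> x y]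
        by (simp add: abs_mult distrib_left)
      also have "\<dots> \<le> exp (- (\<nu> * \<delta>\<^sup>2)) * \<bar>f y\<bar> + gauss (\<nu>/2) x y * exp (- (\<nu> * \<delta>\<^sup>2 / 2)) * \<bar>h x\<bar>"
        by (intro add_mono mult_right_mono g1 g2) auto
      also have "\<dots> \<le> ?R y" using gauss_pos[of \<nu> x y] \<open>e > 0\<close> by (simp add: mult.assoc)
      finally show ?thesis .
    qed
    have intR: "integrable lborel ?R" using ig ig2 intf by auto
    have eq: "gauss_conv \<nu> f x - (pi / \<nu>) powr D * h x = (LINT y|lborel. gauss \<nu> x y * (f y - h x))"
      unfolding gauss_conv_def right_diff_distrib using integrable_gauss_mult[OF intf, of \<nu> x] ig elim
      by (subst Bochner_Integration.integral_diff) auto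
    have "\<bar>gauss_conv \<nu> f x - (pi / \<nu>) powr D * h x\<bar> \<le> (LINT y|lborel. \<bar>gauss \<nu> x y * (f y - h x)\<bar>)"
      unfolding eq by (rule integral_abs_bound)
    also have "\<dots> \<le> (LINT y|lborel. ?R y)"
    proof (rule integral_mono_AE[OF _ intR])
      show "AE y in lborel. \<bar>gauss \<nu> x y * (f y - h x)\<bar> \<le> ?R y" using ae bound by auto
      then show "integrable lborel (\<lambda>y. \<bar>gauss \<nu> x y * (f y - h x)\<bar>)"
        by (intro Bochner_Integration.integrable_bound[OF intR]) auto
    qed
    also have "\<dots> = (pi / \<nu>) powr D * (e / 2) + exp (- (\<nu> * \<delta>\<^sup>2)) * A + (pi / (\<nu> / 2)) powr D * (exp (- (\<nu> * \<delta>\<^sup>2 / 2)) * \<bar>h x\<bar>)"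
      using ig ig2 intf by (simp add: A_def)
    finally have "?c * \<bar>gauss_conv \<nu> f x - (pi / \<nu>) powr D * h x\<bar> \<le> ?c * \<dots>"
      using c(1) by (intro mult_left_mono) auto
    also have "\<dots> = (?c * (pi / \<nu>) powr D) * (e / 2) + ?c * exp (- (\<nu> * \<delta>\<^sup>2)) * A + (?c * (pi / (\<nu> / 2)) powr D) * (exp (- (\<nu> * \<delta>\<^sup>2 / 2)) * \<bar>h x\<bar>)"
      by (simp add: algebra_simps)
    also have "\<dots> = B \<nu>" unfolding c(2) 2 B_def by simp
    also have "?c * \<bar>gauss_conv \<nu> f x - (pi / \<nu>) powr D * h x\<bar> = \<bar>?c * gauss_conv \<nu> f x - (?c * (pi / \<nu>) powr D) * h x\<bar>"
    proof -
      have "?c * gauss_conv \<nu> f x - (?c * (pi / \<nu>) powr D) * h x = ?c * (gauss_conv \<nu> f x - (pi / \<nu>) powr D * h x)"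
        by (simp only: right_diff_distrib mult.assoc)
      then show ?thesis using c(1) by (simp only: abs_mult abs_of_pos)
    qed
    finally show ?case using elim(1) unfolding c(2) by (simp add: dist_real_def D_def)
  qed
qed

text \<open>
Fatou's lemma for the normalised Gaussian averages of f. They converge almost everywhere, and the squares
of their L2 norms are \<integral> exp(-|w|^2 / (2 \<nu>)) |F f(w)|^2, at most the right-hand side. Square integrability
of f is a conclusion.
\<close>

lemma L2_le_fourier_L2:
  fixes f h :: "'a::euclidean_space \<Rightarrow> real"
  assumes f [measurable]: "f \<in> borel_measurable borel" and intf: "integrable lborel f"
    and ae: "AE y in lborel. h y = f y" and cont: "AE x in lborel. isCont h x"
    and K: "integrable lborel (\<lambda>w. (cmod (fourier f w))\<^sup>2)"
  shows "integrable lborel (\<lambda>x. (f x)\<^sup>2)"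
    and "(LINT x|lborel. (f x)\<^sup>2) \<le> (LINT w|lborel. (cmod (fourier f w))\<^sup>2)"
proof -
  let ?K = "LINT w|lborel. (cmod (fourier f w))\<^sup>2"
  let ?c = "\<lambda>k::nat. (real (Suc k) / pi) powr (real DIM('a) / 2)"
  let ?u = "\<lambda>k x. ennreal ((?c k * gauss_conv (real (Suc k)) f x)\<^sup>2)"
  have Suc_top: "filterlim (\<lambda>k. real (Suc k)) at_top sequentially"
    by (rule filterlim_compose[OF filterlim_real_sequentially filterlim_Suc])
  have lim: "AE x in lborel. liminf (\<lambda>k. ?u k x) = ennreal ((f x)\<^sup>2)"
    using ae cont
  proof eventually_elim
    case (elim x)
    have "(\<lambda>k. ?c k * gauss_conv (real (Suc k)) f x) \<longlonglongrightarrow> h x"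
      by (rule filterlim_compose[OF gauss_conv_approximate_identity[OF f intf ae elim(2)] Suc_top])
    then have "(\<lambda>k. ?u k x) \<longlonglongrightarrow> ennreal ((h x)\<^sup>2)"
      by (intro tendsto_ennrealI tendsto_power)
    then show ?case using elim(1) by (simp add: lim_imp_Liminf)
  qed
  have bound: "(\<integral>\<^sup>+ x. ?u k x \<partial>lborel) \<le> ennreal ?K" for k
  proof -
    have i: "integrable lborel (\<lambda>x. (?c k * gauss_conv (real (Suc k)) f x)\<^sup>2)"
      unfolding power_mult_distrib using gauss_conv_L2(1)[OF f intf, of "real (Suc k)"] by (intro integrable_mult_right) auto
    have "(LINT x|lborel. (?c k * gauss_conv (real (Suc k)) f x)\<^sup>2) = (?c k)\<^sup>2 * (LINT x|lborel. (gauss_conv (real (Suc k)) f x)\<^sup>2)"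
      unfolding power_mult_distrib by simp
    also have "\<dots> \<le> (?c k)\<^sup>2 * ((pi / real (Suc k)) powr real DIM('a) * ?K)"
      by (intro mult_left_mono gauss_conv_L2_le[OF f intf _ K]) auto
    also have "(?c k)\<^sup>2 * ((pi / real (Suc k)) powr real DIM('a) * ?K) = ?K"
    proof -
      have "(?c k)\<^sup>2 = (real (Suc k) / pi) powr real DIM('a)"
        by (simp only: power2_eq_square powr_add[symmetric]) simp
      moreover have "(real (Suc k) / pi) powr real DIM('a) * (pi / real (Suc k)) powr real DIM('a) = 1"
        by (simp add: powr_mult[symmetric] del: of_nat_Suc)
      ultimately show ?thesis by (simp only: mult.assoc[symmetric] mult_1)
    qed
    finally show ?thesis using nn_integral_eq_integral[OF i] by (simp add: ennreal_leI)
  qed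
  have "(\<integral>\<^sup>+ x. ennreal ((f x)\<^sup>2) \<partial>lborel) = (\<integral>\<^sup>+ x. liminf (\<lambda>k. ?u k x) \<partial>lborel)"
    using lim by (intro nn_integral_cong_AE) auto
  also have "\<dots> \<le> liminf (\<lambda>k. \<integral>\<^sup>+ x. ?u k x \<partial>lborel)" by (rule nn_integral_liminf) measurable
  also have "\<dots> \<le> liminf (\<lambda>k::nat. ennreal ?K)" by (intro Liminf_mono always_eventually allI bound)
  also have "\<dots> = ennreal ?K" by (simp add: Liminf_const)
  finally have le: "(\<integral>\<^sup>+ x. ennreal ((f x)\<^sup>2) \<partial>lborel) \<le> ennreal ?K" .
  show int: "integrable lborel (\<lambda>x. (f x)\<^sup>2)"
  proof (rule integrableI_bounded)
    show "(\<integral>\<^sup>+ x. ennreal (norm ((f x)\<^sup>2)) \<partial>lborel) < \<infinity>" using le by (simp add: le_less_trans[OF _ ennreal_less_top])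
  qed measurable
  show "(LINT x|lborel. (f x)\<^sup>2) \<le> ?K"
    using le nn_integral_eq_integral[OF int] by (simp add: ennreal_le_iff)
qed

lemma gauss_conv_sup:
  fixes f :: "'a::euclidean_space \<Rightarrow> real"
  assumes f [measurable]: "f \<in> borel_measurable borel" and \<nu>: "\<nu> > 0"
    and f2: "integrable lborel (\<lambda>x. (f x)\<^sup>2)"
  shows "(gauss_conv \<nu> f x)\<^sup>2 \<le> (pi / (2 * \<nu>)) powr (real DIM('a) / 2) * (LINT x|lborel. (f x)\<^sup>2)"
proof -
  have g: "(gauss \<nu> x y)\<^sup>2 = gauss (2 * \<nu>) y x" for y
    by (simp add: gauss_def exp_double[symmetric] norm_minus_commute)
  have "2 * \<nu> > 0" using \<nu> by simp
  note G = integrable_gauss[OF this, of x] integral_gauss[OF this, of x]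
  show ?thesis unfolding gauss_conv_def
    using Cauchy_Schwarz_integral(2)[of "gauss \<nu> x" lborel f] f2 G unfolding g by simp
qed

text \<open>
The lower bound on the form is integrated from the pointwise inequality
exp(-t/4) \<ge> exp(-1/4) (1 - t^s) at t = |w|^2 / \<nu>: for t \<le> 1 the exponential alone suffices, and for t > 1 the
right-hand side is negative. The term t^s is absorbed by the Sobolev weight at the price \<nu>^(-s).
\<close>

lemma gauss_form_sobolev_bounds:
  fixes f :: "'a::euclidean_space \<Rightarrow> real"
  assumes f [measurable]: "f \<in> borel_measurable borel" and intf: "integrable lborel f" and \<nu>: "\<nu> > 0" and s: "s > 0"
    and W: "integrable lborel (sobolev_weighted s f)"
  shows "integrable lborel (\<lambda>w. (cmod (fourier f w))\<^sup>2)"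
    and "(LINT w|lborel. (cmod (fourier f w))\<^sup>2) \<le> (LINT w|lborel. sobolev_weighted s f w)"
    and "exp (-1/4) * (pi / \<nu>) powr (real DIM('a) / 2) *
       ((LINT w|lborel. (cmod (fourier f w))\<^sup>2) - \<nu> powr (-s) * (LINT w|lborel. sobolev_weighted s f w))
     \<le> (LINT z|(lborel \<Otimes>\<^sub>M lborel). gauss \<nu> (fst z) (snd z) * (f (fst z) * f (snd z)))"
    and "(LINT z|(lborel \<Otimes>\<^sub>M lborel). gauss \<nu> (fst z) (snd z) * (f (fst z) * f (snd z)))
     \<le> (pi / \<nu>) powr (real DIM('a) / 2) * (LINT w|lborel. sobolev_weighted s f w)"
proof -
  note [measurable] = fourier_measurable[OF f]
  have le: "(cmod (fourier f w))\<^sup>2 \<le> sobolev_weighted s f w" for w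
    unfolding sobolev_weighted_def using s mult_right_mono[OF ge_one_powr_ge_zero[of "1 + (norm w)\<^sup>2" s], of "(cmod (fourier f w))\<^sup>2"]
    by simp
  show K: "integrable lborel (\<lambda>w. (cmod (fourier f w))\<^sup>2)"
    by (rule Bochner_Integration.integrable_bound[OF W]) (use order_trans[OF le abs_ge_self] in simp_all)
  show KW: "(LINT w|lborel. (cmod (fourier f w))\<^sup>2) \<le> (LINT w|lborel. sobolev_weighted s f w)"
    by (intro integral_mono K W le)
  let ?E = "\<lambda>w. exp (- (norm w)\<^sup>2 / (4 * \<nu>)) * (cmod (fourier f w))\<^sup>2"
  have leE: "?E w \<le> (cmod (fourier f w))\<^sup>2" for w
    using \<nu> by (intro mult_left_le_one_le) auto
  have E: "integrable lborel ?E"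
    by (rule Bochner_Integration.integrable_bound[OF K]) (use leE in \<open>auto simp: abs_mult\<close>)
  have pw: "exp (-1/4) * ((cmod (fourier f w))\<^sup>2 - \<nu> powr (-s) * sobolev_weighted s f w) \<le> ?E w" for w
  proof -
    let ?t = "(norm w)\<^sup>2 / \<nu>"
    have t: "?t \<ge> 0" using \<nu> by simp
    have le1: "exp (-1/4) * (1 - ?t powr s) \<le> exp (- ?t / 4)"
    proof (cases "?t \<le> 1")
      case True
      have "exp (-1/4) * (1 - ?t powr s) \<le> exp (-1/4)" by (simp add: mult_left_le)
      also have "\<dots> \<le> exp (- ?t / 4)" using True by simp
      finally show ?thesis .
    next
      case False
      then have "1 - ?t powr s \<le> 0" using s ge_one_powr_ge_zero[of ?t s] by simp
      then have "exp (-1/4) * (1 - ?t powr s) \<le> 0" by (simp add: mult_le_0_iff)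
      then show ?thesis by (meson exp_ge_zero order_trans)
    qed
    have le2: "?t powr s \<le> \<nu> powr (-s) * (1 + (norm w)\<^sup>2) powr s"
    proof -
      have "?t powr s \<le> ((1 + (norm w)\<^sup>2) / \<nu>) powr s"
        using \<nu> s by (intro powr_mono2 divide_right_mono) auto
      then show ?thesis using \<nu> by (simp add: powr_divide powr_minus field_simps)
    qed
    have "exp (-1/4) * (1 - \<nu> powr (-s) * (1 + (norm w)\<^sup>2) powr s) \<le> exp (-1/4) * (1 - ?t powr s)"
      using le2 by (intro mult_left_mono) auto
    also note le1
    also have "- ?t / 4 = - (norm w)\<^sup>2 / (4 * \<nu>)" by simp
    finally have "exp (-1/4) * (1 - \<nu> powr (-s) * (1 + (norm w)\<^sup>2) powr s) \<le> exp (- (norm w)\<^sup>2 / (4 * \<nu>))" .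
    from mult_right_mono[OF this, of "(cmod (fourier f w))\<^sup>2"] show ?thesis
      by (simp add: sobolev_weighted_def right_diff_distrib left_diff_distrib mult.assoc)
  qed
  have "exp (-1/4) * ((LINT w|lborel. (cmod (fourier f w))\<^sup>2) - \<nu> powr (-s) * (LINT w|lborel. sobolev_weighted s f w)) =
     (LINT w|lborel. exp (-1/4) * ((cmod (fourier f w))\<^sup>2 - \<nu> powr (-s) * sobolev_weighted s f w))"
    using K W by simp
  also have "\<dots> \<le> integral\<^sup>L lborel ?E"
    using K W E pw by (intro integral_mono) auto
  finally have *: "exp (-1/4) * ((LINT w|lborel. (cmod (fourier f w))\<^sup>2) - \<nu> powr (-s) * (LINT w|lborel. sobolev_weighted s f w))
     \<le> integral\<^sup>L lborel ?E" .
  show "exp (-1/4) * (pi / \<nu>) powr (real DIM('a) / 2) *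
       ((LINT w|lborel. (cmod (fourier f w))\<^sup>2) - \<nu> powr (-s) * (LINT w|lborel. sobolev_weighted s f w))
     \<le> (LINT z|(lborel \<Otimes>\<^sub>M lborel). gauss \<nu> (fst z) (snd z) * (f (fst z) * f (snd z)))"
    unfolding gauss_form_fourier[OF f intf \<nu>]
    using mult_left_mono[OF *, of "(pi / \<nu>) powr (real DIM('a) / 2)"] by (simp only: powr_ge_zero ac_simps)
  have "integral\<^sup>L lborel ?E \<le> (LINT w|lborel. sobolev_weighted s f w)"
    using KW integral_mono[OF E K leE] by linarith
  then show "(LINT z|(lborel \<Otimes>\<^sub>M lborel). gauss \<nu> (fst z) (snd z) * (f (fst z) * f (snd z)))
     \<le> (pi / \<nu>) powr (real DIM('a) / 2) * (LINT w|lborel. sobolev_weighted s f w)"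
    unfolding gauss_form_fourier[OF f intf \<nu>] by (intro mult_left_mono) auto
qed

text \<open>
Bounding \<phi>^2 by its supremum would lose a factor \<nu>^(D/4), too much at the rate in question.
By Cauchy-Schwarz, (\<integral> \<phi>^2 p)^2 \<le> sup \<phi>^2 * \<integral> \<phi>^2 * \<integral> p^2, which averages the uniform bound
with the smaller L2 bound.
\<close>

lemma gauss_conv_weighted_L2:
  fixes f p :: "'a::euclidean_space \<Rightarrow> real"
  assumes f [measurable]: "f \<in> borel_measurable borel" and intf: "integrable lborel f" and \<nu>: "\<nu> > 0"
    and f2: "integrable lborel (\<lambda>x. (f x)\<^sup>2)"
    and p [measurable]: "p \<in> borel_measurable borel" and p2: "integrable lborel (\<lambda>x. (p x)\<^sup>2)"
    and K: "(LINT x|lborel. (f x)\<^sup>2) \<le> K" "(LINT x|lborel. (gauss_conv \<nu> f x)\<^sup>2) \<le> (pi / \<nu>) powr real DIM('a) * K"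
    and M: "(LINT x|lborel. (p x)\<^sup>2) \<le> M\<^sup>2" "M \<ge> 0"
  shows "(LINT x|lborel. (gauss_conv \<nu> f x)\<^sup>2 * p x) \<le> M * K * (pi / \<nu>) powr (3 * real DIM('a) / 4)"
proof -
  let ?D = "real DIM('a)"
  let ?S = "(pi / (2 * \<nu>)) powr (?D / 2) * K"
  let ?\<phi> = "gauss_conv \<nu> f"
  have K0: "K \<ge> 0" using K(1) order_trans[OF Bochner_Integration.integral_nonneg[of lborel "\<lambda>x. (f x)\<^sup>2"]] by simp
  have S: "(?\<phi> x)\<^sup>2 \<le> ?S" for x
    using gauss_conv_sup[OF f \<nu> f2, of x] K(1) by (meson mult_left_mono order_trans powr_ge_zero)
  note i2 = gauss_conv_L2(1)[OF f intf \<nu>]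
  have le4: "((?\<phi> x)\<^sup>2)\<^sup>2 \<le> ?S * (?\<phi> x)\<^sup>2" for x
    using mult_right_mono[OF S, of "(?\<phi> x)\<^sup>2"] by (simp add: power2_eq_square)
  have i4: "integrable lborel (\<lambda>x. ((?\<phi> x)\<^sup>2)\<^sup>2)"
    by (rule Bochner_Integration.integrable_bound[OF integrable_mult_right[OF i2, of ?S]]) (use le4 K0 in auto)
  let ?T = "(pi / \<nu>) powr (?D / 2) * K * ((pi / \<nu>) powr ?D * K)"
  have "(LINT x|lborel. ((?\<phi> x)\<^sup>2)\<^sup>2) \<le> (LINT x|lborel. ?S * (?\<phi> x)\<^sup>2)"
    using i4 i2 le4 by (intro integral_mono) auto
  also have "\<dots> = ?S * (LINT x|lborel. (?\<phi> x)\<^sup>2)" by simp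
  also have "\<dots> \<le> ?S * ((pi / \<nu>) powr ?D * K)"
    using K0 by (intro mult_left_mono K(2)) auto
  also have "\<dots> \<le> ?T"
    using \<nu> K0 by (intro mult_right_mono powr_mono2) (auto intro!: divide_left_mono)
  finally have T: "(LINT x|lborel. ((?\<phi> x)\<^sup>2)\<^sup>2) \<le> ?T" .
  have "(LINT x|lborel. (?\<phi> x)\<^sup>2 * p x)\<^sup>2 \<le> (LINT x|lborel. ((?\<phi> x)\<^sup>2)\<^sup>2) * (LINT x|lborel. (p x)\<^sup>2)"
    by (rule Cauchy_Schwarz_integral(2)[OF _ _ i4 p2]) auto
  also have "\<dots> \<le> ?T * M\<^sup>2"
    using K0 by (intro mult_mono T M(1) Bochner_Integration.integral_nonneg) auto
  also have "\<dots> = (M * K * (pi / \<nu>) powr (3 * ?D / 4))\<^sup>2"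
  proof -
    have sum: "3 * ?D / 4 + 3 * ?D / 4 = ?D / 2 + ?D" by simp
    have "((pi / \<nu>) powr (3 * ?D / 4))\<^sup>2 = (pi / \<nu>) powr (?D / 2) * (pi / \<nu>) powr ?D"
      by (simp only: power2_eq_square powr_add[symmetric] sum)
    then have "(M * K * (pi / \<nu>) powr (3 * ?D / 4))\<^sup>2 = M\<^sup>2 * K\<^sup>2 * ((pi / \<nu>) powr (?D / 2) * (pi / \<nu>) powr ?D)"
      unfolding power_mult_distrib by (rule arg_cong)
    moreover have "?T * M\<^sup>2 = M\<^sup>2 * K\<^sup>2 * ((pi / \<nu>) powr (?D / 2) * (pi / \<nu>) powr ?D)"
      by (simp only: power2_eq_square[of K] ac_simps)
    ultimately show ?thesis by (rule trans[OF _ sym, rotated])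
  qed
  finally show ?thesis
    by (rule power2_le_imp_le) (intro mult_nonneg_nonneg K0 M(2) powr_ge_zero)
qed

section \<open>Second moments of sums and U-statistics of an i.i.d. sample\<close>

lemma (in prob_space) integrable_PiM_bounded:
  fixes F :: "('i \<Rightarrow> 'a) \<Rightarrow> real"
  assumes "F \<in> borel_measurable (PiM I (\<lambda>_. M))" "\<And>x. \<bar>F x\<bar> \<le> B"
  shows "integrable (PiM I (\<lambda>_. M)) F"
proof -
  interpret P: prob_space "PiM I (\<lambda>_. M)" by (rule prob_space_PiM) (rule prob_space_axioms)
  show ?thesis using assms by (intro P.integrable_const_bound[where B=B]) auto
qed

lemma (in prob_space) abs_expectation_le:
  fixes f :: "'a \<Rightarrow> real"
  assumes "\<And>x. \<bar>f x\<bar> \<le> B"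
  shows "\<bar>LINT x|M. f x\<bar> \<le> B"
proof (cases "integrable M f")
  case True
  have "\<bar>LINT x|M. f x\<bar> \<le> (LINT x|M. \<bar>f x\<bar>)" by (rule integral_abs_bound)
  also have "\<dots> \<le> B" using True assms by (intro integral_le_const) auto
  finally show ?thesis .
next
  case False
  then show ?thesis using assms[of undefined] by (simp add: not_integrable_integral_eq)
qed

text \<open>
Replacing one coordinate of an i.i.d. sample by a fresh copy does not change expectations. This allows
one coordinate at a time to be integrated out without leaving the index set I, so that all the moments
below are computed on a single product space.
\<close>

lemma (in prob_space) integral_PiM_resample:
  fixes F :: "('i \<Rightarrow> 'a) \<Rightarrow> real"
  assumes I: "finite I" "i \<in> I" and F [measurable]: "F \<in> borel_measurable (PiM I (\<lambda>_. M))" and B: "\<And>x. \<bar>F x\<bar> \<le> B"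
  shows "(LINT x|PiM I (\<lambda>_. M). F x) = (LINT x|PiM I (\<lambda>_. M). LINT y|M. F (x(i := y)))"
proof -
  interpret product_sigma_finite "\<lambda>_::'i. M" by unfold_locales
  let ?J = "I - {i}"
  have J: "finite ?J" "i \<notin> ?J" and IJ: "insert i ?J = I" using I by auto
  have upd [measurable]: "(\<lambda>(f, y). f(i := y)) \<in> measurable (PiM I (\<lambda>_. M) \<Otimes>\<^sub>M M) (PiM I (\<lambda>_. M))"
    using measurable_add_dim[of i I "\<lambda>_. M"] I by (simp add: insert_absorb)
  let ?H = "\<lambda>x. LINT y|M. F (x(i := y))"
  have H: "?H \<in> borel_measurable (PiM I (\<lambda>_. M))"
    using measurable_compose[OF upd F] by (intro borel_measurable_lebesgue_integral) (simp add: split_beta)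
  have "integrable (PiM I (\<lambda>_. M)) F" by (rule integrable_PiM_bounded[OF F B])
  then have 1: "(LINT x|PiM I (\<lambda>_. M). F x) = (LINT x|PiM ?J (\<lambda>_. M). LINT y|M. F (x(i := y)))"
    using product_integral_insert[OF J, of F] unfolding IJ by simp
  have "integrable (PiM I (\<lambda>_. M)) ?H" by (rule integrable_PiM_bounded[OF H abs_expectation_le[OF B]])
  then have "(LINT x|PiM I (\<lambda>_. M). ?H x) = (LINT x|PiM ?J (\<lambda>_. M). LINT z|M. ?H (x(i := z)))"
    using product_integral_insert[OF J, of ?H] unfolding IJ by simp
  also have "\<dots> = (LINT x|PiM ?J (\<lambda>_. M). LINT y|M. F (x(i := y)))"
    by (simp add: prob_space)
  finally show ?thesis using 1 by simp
qed

lemma (in prob_space) integral_PiM_single: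
  fixes u :: "'a \<Rightarrow> real"
  assumes I: "finite I" "i \<in> I" and u [measurable]: "u \<in> borel_measurable M" and B: "\<And>x. \<bar>u x\<bar> \<le> B"
  shows "(LINT x|PiM I (\<lambda>_. M). u (x i)) = (LINT y|M. u y)"
proof -
  interpret P: prob_space "PiM I (\<lambda>_. M)" by (rule prob_space_PiM) (rule prob_space_axioms)
  have "(\<lambda>x. u (x i)) \<in> borel_measurable (PiM I (\<lambda>_. M))" using I by measurable
  from integral_PiM_resample[OF I this B] show ?thesis by (simp add: P.prob_space)
qed

lemma (in prob_space) integral_PiM_pair:
  fixes k :: "'a \<Rightarrow> 'a \<Rightarrow> real"
  assumes I: "finite I" "i \<in> I" "j \<in> I" "i \<noteq> j"
    and k [measurable]: "(\<lambda>z. k (fst z) (snd z)) \<in> borel_measurable (M \<Otimes>\<^sub>M M)" and B: "\<And>x y. \<bar>k x y\<bar> \<le> B"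
  shows "(LINT x|PiM I (\<lambda>_. M). k (x i) (x j)) = (LINT y|M. LINT x|M. k x y)"
proof -
  have "(\<lambda>x. (x i, x j)) \<in> measurable (PiM I (\<lambda>_. M)) (M \<Otimes>\<^sub>M M)" using I by measurable
  from measurable_compose[OF this k]
  have m: "(\<lambda>x. k (x i) (x j)) \<in> borel_measurable (PiM I (\<lambda>_. M))" by simp
  have "(\<lambda>(y, x). k x y) \<in> borel_measurable (M \<Otimes>\<^sub>M M)"
    using measurable_compose[OF measurable_pair_swap' k] by (simp add: split_beta)
  then have m2: "(\<lambda>y. LINT x|M. k x y) \<in> borel_measurable M" by (rule borel_measurable_lebesgue_integral)
  have "(LINT x|PiM I (\<lambda>_. M). k (x i) (x j)) = (LINT x|PiM I (\<lambda>_. M). LINT y|M. k y (x j))"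
    using integral_PiM_resample[OF I(1,2) m B] I(4) by simp
  also have "\<dots> = (LINT y|M. LINT x|M. k x y)"
    by (rule integral_PiM_single[OF I(1,3) m2 abs_expectation_le[OF B]])
  finally show ?thesis .
qed

lemma (in prob_space) second_moment_sum:
  fixes u :: "'a \<Rightarrow> real"
  assumes u [measurable]: "u \<in> borel_measurable M" and B: "\<And>x. \<bar>u x\<bar> \<le> B" and zero: "(LINT x|M. u x) = 0"
    and I: "finite I"
  shows "(LINT x|PiM I (\<lambda>_. M). (\<Sum>i\<in>I. u (x i))\<^sup>2) = real (card I) * (LINT x|M. (u x)\<^sup>2)"
proof -
  have B2: "\<bar>u x * u y\<bar> \<le> B * B" for x y unfolding abs_mult using B by (intro mult_mono) (auto intro: order_trans[OF abs_ge_zero])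
  have m: "(\<lambda>x. u (x i) * u (x j)) \<in> borel_measurable (PiM I (\<lambda>_. M))" if "i \<in> I" "j \<in> I" for i j
    using that by measurable
  have int: "integrable (PiM I (\<lambda>_. M)) (\<lambda>x. u (x i) * u (x j))" if "i \<in> I" "j \<in> I" for i j
    by (rule integrable_PiM_bounded[OF m[OF that] B2])
  have E: "(LINT x|PiM I (\<lambda>_. M). u (x i) * u (x j)) = (if i = j then (LINT x|M. (u x)\<^sup>2) else 0)" if "i \<in> I" "j \<in> I" for i j
  proof (cases "i = j")
    case True
    then show ?thesis using integral_PiM_single[OF I that(1), of "\<lambda>x. u x * u x" "B * B"] abs_le_D1[OF B2]
      by (simp add: power2_eq_square)
  next
    case False
    then show ?thesis using integral_PiM_pair[OF I that False, of "\<lambda>x y. u x * u y" "B * B"] B2 zero by simp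
  qed
  have "(LINT x|PiM I (\<lambda>_. M). (\<Sum>i\<in>I. u (x i))\<^sup>2) = (LINT x|PiM I (\<lambda>_. M). (\<Sum>i\<in>I. \<Sum>j\<in>I. u (x i) * u (x j)))"
    by (simp add: power2_eq_square sum_product)
  also have "\<dots> = (\<Sum>i\<in>I. \<Sum>j\<in>I. (LINT x|PiM I (\<lambda>_. M). u (x i) * u (x j)))"
    using int by (simp add: Bochner_Integration.integral_sum Bochner_Integration.integrable_sum)
  also have "\<dots> = (\<Sum>i\<in>I. \<Sum>j\<in>I. if i = j then (LINT x|M. (u x)\<^sup>2) else 0)"
    using E by (intro sum.cong) auto
  finally show ?thesis using I by simp
qed

definition offdiag :: "nat \<Rightarrow> (nat \<times> nat) set" where
  "offdiag n = {(i, j). i < n \<and> j < n \<and> i \<noteq> j}"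

lemma offdiag_Sigma: "offdiag n = (SIGMA i:{..<n}. {..<n} - {i})"
  by (auto simp: offdiag_def)

lemma finite_offdiag: "finite (offdiag n)"
  unfolding offdiag_Sigma by auto

lemma sum_offdiag_fst: "(\<Sum>(i, j)\<in>offdiag n. g i) = (real n - 1) * (\<Sum>i<n. g i :: real)"
proof -
  have "(\<Sum>(i, j)\<in>offdiag n. g i) = (\<Sum>i<n. \<Sum>j\<in>{..<n} - {i}. g i)"
    unfolding offdiag_Sigma by (subst sum.Sigma) auto
  also have "\<dots> = (\<Sum>i<n. (real n - 1) * g i)"
    by (intro sum.cong) (auto simp: of_nat_diff)
  finally show ?thesis by (simp add: sum_distrib_left)
qed

lemma sum_offdiag_snd: "(\<Sum>(i, j)\<in>offdiag n. g j) = (real n - 1) * (\<Sum>i<n. g i :: real)"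
proof -
  have "(\<Sum>(i, j)\<in>offdiag n. g j) = (\<Sum>(i, j)\<in>offdiag n. g i)"
    by (rule sum.reindex_bij_witness[of _ prod.swap prod.swap]) (auto simp: offdiag_def)
  then show ?thesis by (simp add: sum_offdiag_fst)
qed

lemma card_offdiag: "real (card (offdiag n)) = real n * (real n - 1)"
  using sum_offdiag_fst[of "\<lambda>_. 1" n] by (simp add: split_def)

text \<open>
If the unordered pairs {i, j} and {p, q} differ, some index occurs in only one of the two factors;
integrating that coordinate first gives zero. Each ordered pair therefore meets only itself and its swap,
whence the factor 2.
\<close>

lemma (in prob_space) second_moment_degenerate:
  fixes k :: "'a \<Rightarrow> 'a \<Rightarrow> real"
  assumes k [measurable]: "(\<lambda>z. k (fst z) (snd z)) \<in> borel_measurable (M \<Otimes>\<^sub>M M)" and B: "\<And>x y. \<bar>k x y\<bar> \<le> B"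
    and sym: "\<And>x y. k x y = k y x" and zero: "\<And>y. (LINT x|M. k x y) = 0"
  shows "(LINT x|PiM {..<n} (\<lambda>_. M). (\<Sum>(i, j)\<in>offdiag n. k (x i) (x j))\<^sup>2)
    = 2 * (real n * (real n - 1)) * (LINT y|M. LINT x|M. (k x y)\<^sup>2)"
proof -
  let ?P = "PiM {..<n} (\<lambda>_. M)"
  let ?\<kappa> = "LINT y|M. LINT x|M. (k x y)\<^sup>2"
  let ?k = "\<lambda>a x. k (x (fst a)) (x (snd a))"
  have B2: "\<bar>k x y * k x' y'\<bar> \<le> B * B" for x y x' y' unfolding abs_mult using B by (intro mult_mono) (auto intro: order_trans[OF abs_ge_zero])
  have m1: "?k a \<in> borel_measurable ?P" if "a \<in> offdiag n" for a
  proof -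
    have "(\<lambda>x. (x (fst a), x (snd a))) \<in> measurable ?P (M \<Otimes>\<^sub>M M)"
      using that by (auto simp: offdiag_def)
    from measurable_compose[OF this k] show ?thesis by simp
  qed
  have m: "(\<lambda>x. ?k a x * ?k b x) \<in> borel_measurable ?P" if "a \<in> offdiag n" "b \<in> offdiag n" for a b
    using m1 that by (intro borel_measurable_times) auto
  have int: "integrable ?P (\<lambda>x. ?k a x * ?k b x)" if "a \<in> offdiag n" "b \<in> offdiag n" for a b
    by (rule integrable_PiM_bounded[OF m[OF that] B2])
  have E: "(LINT x|?P. ?k a x * ?k b x) = (if b \<in> {a, prod.swap a} then ?\<kappa> else 0)" if ab: "a \<in> offdiag n" "b \<in> offdiag n" for a b
  proof (cases "b \<in> {a, prod.swap a}")
    case True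
    then have "?k a x * ?k b x = (k (x (fst a)) (x (snd a)))\<^sup>2" for x
      using sym by (auto simp: power2_eq_square)
    moreover have "(LINT x|?P. (k (x (fst a)) (x (snd a)))\<^sup>2) = ?\<kappa>"
      using ab abs_le_D1[OF B2] by (intro integral_PiM_pair[where B="B * B"]) (auto simp: offdiag_def power2_eq_square)
    ultimately show ?thesis using True by simp
  next
    case False
    obtain i j where a: "a = (i, j)" "i < n" "j < n" "i \<noteq> j" using ab by (auto simp: offdiag_def)
    obtain p q where b: "b = (p, q)" "p < n" "q < n" "p \<noteq> q" using ab by (auto simp: offdiag_def)
    have "i \<notin> {p, q} \<or> j \<notin> {p, q}" using False a b by auto
    then have "(LINT x|?P. ?k a x * ?k b x) = 0"
    proof
      assume "i \<notin> {p, q}"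
      then have upd: "?k a (x(i := y)) * ?k b (x(i := y)) = k y (x j) * k (x p) (x q)" for x y using a b by auto
      show ?thesis
        using integral_PiM_resample[OF _ _ m[OF ab] B2, of i] a(2) unfolding upd by (simp add: zero)
    next
      assume "j \<notin> {p, q}"
      then have upd: "?k a (x(j := y)) * ?k b (x(j := y)) = k y (x i) * k (x p) (x q)" for x y using a b sym by auto
      show ?thesis
        using integral_PiM_resample[OF _ _ m[OF ab] B2, of j] a(3) unfolding upd by (simp add: zero)
    qed
    then show ?thesis using False by simp
  qed
  have "(LINT x|?P. (\<Sum>(i, j)\<in>offdiag n. k (x i) (x j))\<^sup>2) = (LINT x|?P. (\<Sum>a\<in>offdiag n. \<Sum>b\<in>offdiag n. ?k a x * ?k b x))"
    by (simp add: power2_eq_square sum_product split_def)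
  also have "\<dots> = (\<Sum>a\<in>offdiag n. \<Sum>b\<in>offdiag n. (LINT x|?P. ?k a x * ?k b x))"
    using int by (simp add: Bochner_Integration.integral_sum Bochner_Integration.integrable_sum)
  also have "\<dots> = (\<Sum>a\<in>offdiag n. \<Sum>b\<in>offdiag n. if b \<in> {a, prod.swap a} then ?\<kappa> else 0)"
    using E by (intro sum.cong) auto
  also have "\<dots> = (\<Sum>a\<in>offdiag n. 2 * ?\<kappa>)"
  proof (intro sum.cong refl)
    fix a assume a: "a \<in> offdiag n"
    have "(\<Sum>b\<in>offdiag n. if b \<in> {a, prod.swap a} then ?\<kappa> else 0) = (\<Sum>b\<in>{a, prod.swap a}. ?\<kappa>)"
      using a by (intro sum.mono_neutral_cong_right finite_offdiag) (auto simp: offdiag_def)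
    also have "\<dots> = 2 * ?\<kappa>" using a by (auto simp: offdiag_def)
    finally show "(\<Sum>b\<in>offdiag n. if b \<in> {a, prod.swap a} then ?\<kappa> else 0) = 2 * ?\<kappa>" .
  qed
  also have "\<dots> = 2 * (real n * (real n - 1)) * ?\<kappa>" by (simp add: card_offdiag)
  finally show ?thesis .
qed

section \<open>The test statistic under an arbitrary distribution\<close>

lemma (in prob_space) integrable_bounded:
  fixes f :: "'a \<Rightarrow> real"
  assumes "f \<in> borel_measurable M" "\<And>x. \<bar>f x\<bar> \<le> B"
  shows "integrable M f"
  using assms by (intro integrable_const_bound[where B=B]) auto

text \<open>
The exact value is 1, but a crude count of all n^4 quadruples is enough: only the order of magnitude
of the normalisation matters.
\<close>

lemma distinct_quadruples_weight:
  assumes "n \<ge> 4"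
  shows "fact (n - 4) / fact n * real (card {(i1, i2, j1, j2). i1 < n \<and> i2 < n \<and> j1 < n \<and> j2 < n \<and> card {i1, i2, j1, j2} = 4}) \<le> 16"
    (is "_ * real (card ?Q) \<le> 16")
proof -
  have "card ?Q \<le> card ({..<n} \<times> {..<n} \<times> {..<n} \<times> {..<n})" by (rule card_mono) auto
  then have "card ?Q \<le> n * (n * (n * n))" by (simp add: card_cartesian_product)
  then have "real (card ?Q) \<le> real (n * (n * (n * n)))" by (rule of_nat_mono)
  then have card: "real (card ?Q) \<le> real n * (real n * (real n * real n))" by (simp only: of_nat_mult)
  obtain m where m: "n = m + 4" using assms by (metis add.commute le_Suc_ex)
  have fact: "(fact n :: real) = real n * (real n - 1) * (real n - 2) * (real n - 3) * fact (n - 4)"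
    unfolding m by (simp add: fact_Suc numeral_eq_Suc algebra_simps)
  have n: "real n \<ge> 4" using assms by simp
  have "(real n * (1/2)) * (real n * (1/2)) * (real n * (1/4)) \<le> (real n - 1) * (real n - 2) * (real n - 3)"
    using n by (intro mult_mono) auto
  then have "16 * real n * ((real n * (1/2)) * (real n * (1/2)) * (real n * (1/4))) \<le> 16 * real n * ((real n - 1) * (real n - 2) * (real n - 3))"
    by (rule mult_left_mono) simp
  then have "real n * (real n * (real n * real n)) \<le> 16 * (real n * (real n - 1) * (real n - 2) * (real n - 3))"
    by (simp add: mult.left_commute mult.assoc)
  with card have "real (card ?Q) \<le> 16 * (real n * (real n - 1) * (real n - 2) * (real n - 3))" by linarith
  moreover have "0 < real n * (real n - 1) * (real n - 2) * (real n - 3)" using n by simp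
  moreover have "(fact (n - 4) :: real) / fact n = 1 / (real n * (real n - 1) * (real n - 2) * (real n - 3))"
    unfolding fact by simp
  ultimately show ?thesis by (simp add: divide_le_eq)
qed

lemma card_4_distinct: "card {a, b, c, d} = 4 \<Longrightarrow> a \<noteq> c"
  by (auto simp: card_insert_if split: if_splits)

text \<open>
The middle sum is positive and enters with a minus sign; in the last sum one factor is at most 1, which reduces it to averages of single kernel values, whose expectation
has the right order already.
\<close>

lemma s2_tilde_le:
  assumes "n \<ge> 4" "\<nu> > 0"
  shows "s2_tilde n \<nu> X \<le> 1 / (real n * (real n - 1)) * (\<Sum>(i, j)\<in>offdiag n. gauss \<nu> (X i) (X j))
     + fact (n - 4) / fact n * (\<Sum>(i1, i2, j1, j2) \<in> {(i1, i2, j1, j2). i1 < n \<and> i2 < n \<and> j1 < n \<and> j2 < n \<and>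
            card {i1, i2, j1, j2} = 4}. gauss \<nu> (X i1) (X j1))"
proof -
  have 1: "1 / (real n * (real n - 1)) * (\<Sum>(i, j)\<in>{(i, j). i < n \<and> j < n \<and> i \<noteq> j}. gauss (2 * \<nu>) (X i) (X j))
     \<le> 1 / (real n * (real n - 1)) * (\<Sum>(i, j)\<in>offdiag n. gauss \<nu> (X i) (X j))"
    unfolding offdiag_def using assms
    by (intro mult_left_mono sum_mono) (auto simp: gauss_def intro!: mult_right_mono)
  have 2: "0 \<le> 2 * fact (n - 3) / fact n *
       (\<Sum>(i, j1, j2) \<in> {(i, j1, j2). i < n \<and> j1 < n \<and> j2 < n \<and> card {i, j1, j2} = 3}.
          gauss \<nu> (X i) (X j1) * gauss \<nu> (X i) (X j2))"
    by (intro mult_nonneg_nonneg sum_nonneg divide_nonneg_nonneg) (auto intro!: mult_nonneg_nonneg less_imp_le[OF gauss_pos])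
  have 3: "fact (n - 4) / fact n *
       (\<Sum>(i1, i2, j1, j2) \<in> {(i1, i2, j1, j2). i1 < n \<and> i2 < n \<and> j1 < n \<and> j2 < n \<and>
            card {i1, i2, j1, j2} = 4}.
          gauss \<nu> (X i1) (X j1) * gauss \<nu> (X i2) (X j2)) \<le> fact (n - 4) / fact n * (\<Sum>(i1, i2, j1, j2) \<in> {(i1, i2, j1, j2). i1 < n \<and> i2 < n \<and> j1 < n \<and> j2 < n \<and>
            card {i1, i2, j1, j2} = 4}. gauss \<nu> (X i1) (X j1))"
    using assms by (intro mult_left_mono sum_mono) (auto intro!: mult_left_le gauss_le_1 less_imp_le[OF gauss_pos])
  show ?thesis using 1 2 3 unfolding s2_tilde_def by linarith
qed

text \<open>
Here y and w are the linear and the degenerate part of the error in g, and S dominates the squared normalisation.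
The constants are chosen so that the sum of the three normalised errors being below 1 forces |y| < \<theta>/8
and |w| < \<theta>/4, hence g > \<theta>/2, and |z| sh \<le> n \<theta> / (2 sqrt 2), hence the rejection.
A single nonnegative quantity then controls the whole event.
\<close>

lemma reject_if_close:
  fixes n :: nat and \<theta> z y w S g sh :: real
  assumes n: "n \<ge> 4" and \<theta>: "\<theta> > 0" and g: "g = \<theta> + 2 * y + w"
    and sh: "sh > 0" "sh\<^sup>2 \<le> S"
    and V: "64 * y\<^sup>2 / \<theta>\<^sup>2 + 16 * w\<^sup>2 / \<theta>\<^sup>2 + 8 * (z\<^sup>2 + 1) * S / ((real n)\<^sup>2 * \<theta>\<^sup>2) < 1"
  shows "z < real n / sqrt 2 * inverse sh * g"
proof -
  have n0: "real n > 0" using n by simp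
  have S: "0 \<le> S" using sh by (meson order_trans zero_le_power2)
  have z1: "z\<^sup>2 + 1 > 0" by (simp add: add_nonneg_pos)
  have t: "0 \<le> 64 * y\<^sup>2 / \<theta>\<^sup>2" "0 \<le> 16 * w\<^sup>2 / \<theta>\<^sup>2" "0 \<le> 8 * (z\<^sup>2 + 1) * S / ((real n)\<^sup>2 * \<theta>\<^sup>2)"
    using S z1 by auto
  have y: "\<bar>8 * y\<bar> < \<theta>" and w: "\<bar>4 * w\<bar> < \<theta>" and SS: "8 * (z\<^sup>2 + 1) * S < (real n)\<^sup>2 * \<theta>\<^sup>2"
  proof -
    have "64 * y\<^sup>2 / \<theta>\<^sup>2 < 1" using V t by linarith
    then have "(8 * y)\<^sup>2 < \<theta>\<^sup>2" using \<theta> by (simp add: divide_less_eq power_mult_distrib)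
    then show "\<bar>8 * y\<bar> < \<theta>" using \<theta> power2_less_imp_less[of "\<bar>8 * y\<bar>" \<theta>] by simp
    have "16 * w\<^sup>2 / \<theta>\<^sup>2 < 1" using V t by linarith
    then have "(4 * w)\<^sup>2 < \<theta>\<^sup>2" using \<theta> by (simp add: divide_less_eq power_mult_distrib)
    then show "\<bar>4 * w\<bar> < \<theta>" using \<theta> power2_less_imp_less[of "\<bar>4 * w\<bar>" \<theta>] by simp
    have "8 * (z\<^sup>2 + 1) * S / ((real n)\<^sup>2 * \<theta>\<^sup>2) < 1" using V t by linarith
    then show "8 * (z\<^sup>2 + 1) * S < (real n)\<^sup>2 * \<theta>\<^sup>2" using \<theta> n0 by (simp add: divide_less_eq)
  qed
  have gt: "g > \<theta> / 2" using y w unfolding g by linarith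
  have "(\<bar>z\<bar> * sh)\<^sup>2 \<le> (z\<^sup>2 + 1) * S"
    unfolding power_mult_distrib power2_abs using sh(2) z1 by (intro mult_mono) auto
  also have "\<dots> \<le> (real n / sqrt 2 * (\<theta> / 2))\<^sup>2"
  proof -
    have "8 * ((z\<^sup>2 + 1) * S) < (real n)\<^sup>2 * \<theta>\<^sup>2" using SS by (simp only: mult.assoc)
    moreover have "(real n / sqrt 2 * (\<theta> / 2))\<^sup>2 = (real n)\<^sup>2 * \<theta>\<^sup>2 / 8" by (simp add: power_mult_distrib power_divide)
    ultimately show ?thesis by linarith
  qed
  finally have "\<bar>z\<bar> * sh \<le> real n / sqrt 2 * (\<theta> / 2)"
    by (rule power2_le_imp_le) (use \<theta> in simp)
  also have "\<dots> < real n / sqrt 2 * g" using gt n0 by (intro mult_strict_left_mono) auto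
  finally have *: "\<bar>z\<bar> * sh < real n / sqrt 2 * g" .
  have "z * sh \<le> \<bar>z\<bar> * sh" using sh by (intro mult_right_mono) auto
  with * have "z * sh < real n / sqrt 2 * g" by linarith
  then have "z < real n / sqrt 2 * g / sh" using sh(1) by (subst pos_less_divide_eq)
  also have "\<dots> = real n / sqrt 2 * inverse sh * g" by (simp only: divide_inverse ac_simps)
  finally show ?thesis .
qed

text \<open>
Adding the squares of three further sign combinations of a, b, c, d completes the left-hand side
to 4 times the sum of squares.
\<close>

lemma centered_square_le:
  fixes a b c d :: real
  assumes "0 \<le> a" "a \<le> 1" "0 \<le> b" "b \<le> 1" "0 \<le> c" "c \<le> 1" "0 \<le> d" "d \<le> 1"
  shows "(a - b - c + d)\<^sup>2 \<le> 4 * (a + b + c + d)"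
proof -
  have sq: "x\<^sup>2 \<le> x" if "0 \<le> x" "x \<le> 1" for x :: real
    using that by (simp add: power2_eq_square mult_left_le)
  have "(a - b - c + d)\<^sup>2 + (a + b - c - d)\<^sup>2 + (a - b + c - d)\<^sup>2 + (a + b + c + d)\<^sup>2 = 4 * (a\<^sup>2 + b\<^sup>2 + c\<^sup>2 + d\<^sup>2)"
    by (simp add: power2_eq_square algebra_simps)
  then have "(a - b - c + d)\<^sup>2 \<le> 4 * (a\<^sup>2 + b\<^sup>2 + c\<^sup>2 + d\<^sup>2)"
    using zero_le_power2[of "a + b - c - d"] zero_le_power2[of "a - b + c - d"] zero_le_power2[of "a + b + c + d"] by linarith
  also have "\<dots> \<le> 4 * (a + b + c + d)"
    by (intro mult_left_mono add_mono sq assms) simp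
  finally show ?thesis .
qed

text \<open>
With b and a the kernel means under the true and the null distribution and \<phi> = b - a, the kernel centred under the
null equals \<theta> + (\<phi> x - E \<phi>) + (\<phi> y - E \<phi>) + k x y, where k is the kernel centred under the true distribution.
The bound is Markov's inequality applied to the quantity of reject_if_close.
\<close>

lemma rejection_probability_ge:
  fixes M :: "'a::euclidean_space measure" and p0 :: "'a \<Rightarrow> real" and z :: real
  assumes M: "prob_space M" "sets M = sets borel" and N: "prob_space (law p0)"
    and \<nu>: "\<nu> > 0" and n: "n \<ge> 4"
  defines "\<phi> \<equiv> \<lambda>x. (LINT u|M. gauss \<nu> x u) - (LINT u|law p0. gauss \<nu> x u)"
  defines "\<theta> \<equiv> (LINT x|M. \<phi> x) - (LINT x|law p0. \<phi> x)"
  defines "e \<equiv> (LINT x|M. LINT u|M. gauss \<nu> x u)"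
  defines "q \<equiv> (LINT x|M. (\<phi> x)\<^sup>2)"
  assumes \<theta>: "\<theta> > 0"
  shows "measure (PiM {..<n} (\<lambda>_. M)) {X \<in> space (PiM {..<n} (\<lambda>_. M)). T_GOF p0 n \<nu> X > z}
     \<ge> 1 - (64 * q / (real n * \<theta>\<^sup>2) + 1024 * e / ((real n)\<^sup>2 * \<theta>\<^sup>2)
            + 8 * (z\<^sup>2 + 1) * (17 * e + 1 / (real n)\<^sup>2) / ((real n)\<^sup>2 * \<theta>\<^sup>2))"
proof -
  interpret M: prob_space M by fact
  interpret N: prob_space "law p0" by fact
  interpret MN: pair_prob_space M "law p0" ..
  interpret NN: pair_prob_space "law p0" "law p0" ..
  let ?P = "PiM {..<n} (\<lambda>_. M)"
  interpret P: prob_space ?P by (rule prob_space_PiM) (rule M)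
  note [measurable_cong] = M(2)
  have [measurable_cong]: "sets (law p0) = sets borel" by (simp add: law_def)
  define b where "b x = (LINT u|M. gauss \<nu> x u)" for x
  define a where "a x = (LINT u|law p0. gauss \<nu> x u)" for x
  define c where "c = (LINT x|law p0. a x)"
  define m where "m = (LINT x|M. \<phi> x)"
  define k where "k x y = gauss \<nu> x y - b x - b y + e" for x y
  define u where "u x = \<phi> x - m" for x
  have g01: "0 \<le> gauss \<nu> x y" "gauss \<nu> x y \<le> 1" "\<bar>gauss \<nu> x y\<bar> \<le> 1" for x y :: 'a
    using gauss_pos[of \<nu> x y] gauss_le_1[of \<nu> x y] \<nu> by auto
  have [measurable]: "b \<in> borel_measurable borel" unfolding b_def[abs_def] by measurable
  have [measurable]: "a \<in> borel_measurable borel" unfolding a_def[abs_def] by measurable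
  have \<phi>: "\<phi> x = b x - a x" for x by (simp add: \<phi>_def a_def b_def)
  have \<phi>m [measurable]: "\<phi> \<in> borel_measurable borel" unfolding \<phi>[abs_def] by measurable
  have um [measurable]: "u \<in> borel_measurable borel" unfolding u_def[abs_def] by measurable
  have ig: "integrable M (gauss \<nu> x)" "integrable (law p0) (gauss \<nu> x)" for x
    by (rule M.integrable_bounded[OF _ g01(3)], measurable) (rule N.integrable_bounded[OF _ g01(3)], measurable)
  have ig': "integrable M (\<lambda>x. gauss \<nu> x y)" for y
    by (rule M.integrable_bounded[OF _ g01(3)], measurable)
  have b01: "0 \<le> b x" "b x \<le> 1" for x
    unfolding b_def using g01 ig by (auto intro!: M.integral_le_const Bochner_Integration.integral_nonneg)
  have a01: "0 \<le> a x" "a x \<le> 1" for x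
    unfolding a_def using g01 ig by (auto intro!: N.integral_le_const Bochner_Integration.integral_nonneg)
  have abs_b: "\<bar>b x\<bar> \<le> 1" for x using b01[of x] by simp
  have ib: "integrable M b" "integrable (law p0) b"
    by (rule M.integrable_bounded[OF _ abs_b] N.integrable_bounded[OF _ abs_b], measurable)+
  have abs_a: "\<bar>a x\<bar> \<le> 1" for x using a01[of x] by simp
  have ia: "integrable M a" "integrable (law p0) a"
    by (rule M.integrable_bounded[OF _ abs_a] N.integrable_bounded[OF _ abs_a], measurable)+
  have e: "e = (LINT x|M. b x)" by (simp add: e_def b_def)
  have e01: "0 \<le> e" "e \<le> 1"
    unfolding e using b01 ib by (auto intro!: M.integral_le_const Bochner_Integration.integral_nonneg)
  have \<phi>1: "\<bar>\<phi> x\<bar> \<le> 1" for x using a01[of x] b01[of x] unfolding \<phi> by linarith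
  have i\<phi>: "integrable M \<phi>" by (rule M.integrable_bounded[OF _ \<phi>1]) measurable
  have m1: "\<bar>m\<bar> \<le> 1" unfolding m_def by (rule M.abs_expectation_le[OF \<phi>1])
  have u2: "\<bar>u x\<bar> \<le> 2" for x using \<phi>1[of x] m1 unfolding u_def by linarith
  have k4: "\<bar>k x y\<bar> \<le> 4" for x y
    using g01[of x y] b01[of x] b01[of y] e01 unfolding k_def by linarith
  \<comment> \<open>The mixed term of the quadratic form is the same from either side.\<close>
  have swap: "(LINT x|law p0. b x) = (LINT x|M. a x)"
  proof -
    have "integrable (M \<Otimes>\<^sub>M law p0) (\<lambda>(x, y). gauss \<nu> x y)"
      by (rule MN.P.integrable_bounded[where B=1]) (use g01 in \<open>auto simp: split_beta\<close>)
    from MN.Fubini_integral[OF this] show ?thesis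
      unfolding a_def b_def by (simp add: gauss_commute)
  qed
  have m: "m = e - (LINT x|M. a x)" unfolding m_def \<phi>[abs_def] e using ib ia by simp
  have "(LINT x|law p0. \<phi> x) = (LINT x|M. a x) - c" unfolding \<phi>[abs_def] c_def using ib ia swap by simp
  then have \<theta>eq: "\<theta> = 2 * m + c - e" unfolding \<theta>_def m_def[symmetric] using m by simp
  have cc: "(LINT w|(law p0 \<Otimes>\<^sub>M law p0). gauss \<nu> (fst w) (snd w)) = c"
  proof -
    have "integrable (law p0 \<Otimes>\<^sub>M law p0) (\<lambda>w. gauss \<nu> (fst w) (snd w))"
      by (rule NN.P.integrable_bounded[OF _ g01(3)]) measurable
    from NN.integral_fst'[OF this] show ?thesis by (simp add: c_def a_def)
  qed
  have centered: "gauss_centered p0 \<nu> x y = k x y + u x + u y + \<theta>" for x y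
    unfolding gauss_centered_def cc \<theta>eq k_def u_def \<phi> a_def[symmetric] gauss_commute[of \<nu> _ y] by simp
  have km [measurable]: "(\<lambda>z. k (fst z) (snd z)) \<in> borel_measurable (M \<Otimes>\<^sub>M M)" unfolding k_def by measurable
  have ksym: "k x y = k y x" for x y by (simp add: k_def gauss_commute)
  have k0: "(LINT x|M. k x y) = 0" for y
  proof -
    have "(LINT x|M. gauss \<nu> x y) = b y" unfolding b_def by (simp add: gauss_commute[of \<nu> _ y])
    then show ?thesis unfolding k_def using ig'[of y] ib e by (simp add: M.prob_space)
  qed
  have u0: "(LINT x|M. u x) = 0" unfolding u_def using i\<phi> by (simp add: M.prob_space m_def)
  have ik2: "integrable M (\<lambda>x. (k x y)\<^sup>2)" for y
  proof (rule M.integrable_bounded[where B=16])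
    show "(\<lambda>x. (k x y)\<^sup>2) \<in> borel_measurable M" unfolding k_def by measurable
    show "\<bar>(k x y)\<^sup>2\<bar> \<le> 16" for x using power_mono[OF k4[of x y], of 2] by simp
  qed
  have kk: "(LINT y|M. LINT x|M. (k x y)\<^sup>2) \<le> 16 * e"
  proof -
    have le: "(LINT x|M. (k x y)\<^sup>2) \<le> 8 * b y + 8 * e" for y
    proof -
      have "(LINT x|M. (k x y)\<^sup>2) \<le> (LINT x|M. 4 * (gauss \<nu> x y + b x + b y + e))"
        unfolding k_def using ig'[of y] ib
        by (intro integral_mono centered_square_le g01 b01 e01 ik2[unfolded k_def]) auto
      also have "\<dots> = 8 * b y + 8 * e"
      proof -
        have "(LINT x|M. gauss \<nu> x y) = b y" unfolding b_def by (simp add: gauss_commute[of \<nu> _ y])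
        then show ?thesis using ig'[of y] ib e by (simp add: M.prob_space)
      qed
      finally show ?thesis .
    qed
    have "(LINT y|M. LINT x|M. (k x y)\<^sup>2) \<le> (LINT y|M. 8 * b y + 8 * e)"
    proof (rule integral_mono[OF _ _ le])
      show "integrable M (\<lambda>y. 8 * b y + 8 * e)" using ib by simp
      have "(\<lambda>y. LINT x|M. (k x y)\<^sup>2) \<in> borel_measurable M"
        unfolding k_def by measurable
      then show "integrable M (\<lambda>y. LINT x|M. (k x y)\<^sup>2)"
        by (rule M.integrable_bounded[where B=16]) (rule M.abs_expectation_le, use power_mono[OF k4, of _ _ 2] in simp)
    qed
    then show ?thesis using ib e by (simp add: M.prob_space)
  qed
  have uu: "(LINT x|M. (u x)\<^sup>2) \<le> q"
  proof -
    have i2: "integrable M (\<lambda>x. (\<phi> x)\<^sup>2)"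
      by (rule M.integrable_bounded[where B=1]) (measurable, use \<phi>1 in \<open>simp add: abs_square_le_1\<close>)
    have "(u x)\<^sup>2 = (\<phi> x)\<^sup>2 - 2 * m * \<phi> x + m\<^sup>2" for x by (simp add: u_def power2_eq_square algebra_simps)
    then have "(LINT x|M. (u x)\<^sup>2) = q - m\<^sup>2"
      using i2 i\<phi> by (simp add: M.prob_space q_def m_def[symmetric] power2_eq_square)
    then show ?thesis by simp
  qed

  let ?Q = "{(i1, i2, j1, j2). i1 < n \<and> i2 < n \<and> j1 < n \<and> j2 < n \<and> card {i1, i2, j1, j2} = 4}"
  define Y where "Y X = (\<Sum>i<n. u (X i)) / real n" for X :: "nat \<Rightarrow> 'a"
  define W where "W X = (\<Sum>(i, j)\<in>offdiag n. k (X i) (X j)) / (real n * (real n - 1))" for X :: "nat \<Rightarrow> 'a"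
  define S where "S X = 1 / (real n * (real n - 1)) * (\<Sum>(i, j)\<in>offdiag n. gauss \<nu> (X i) (X j))
     + fact (n - 4) / fact n * (\<Sum>(i1, i2, j1, j2) \<in> ?Q. gauss \<nu> (X i1) (X j1)) + 1 / (real n)\<^sup>2" for X :: "nat \<Rightarrow> 'a"
  \<comment> \<open>The normalised error of reject_if_close, with linear part Y, degenerate part W and
    S bounding the truncated variance estimator.\<close>
  define V where "V X = 64 * (Y X)\<^sup>2 / \<theta>\<^sup>2 + 16 * (W X)\<^sup>2 / \<theta>\<^sup>2 + 8 * (z\<^sup>2 + 1) * S X / ((real n)\<^sup>2 * \<theta>\<^sup>2)" for X :: "nat \<Rightarrow> 'a"
  have nn: "real n * (real n - 1) > 0" using n by simp
  have gam: "gamma2_hat p0 n \<nu> X = \<theta> + 2 * Y X + W X" for X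
  proof -
    have "(\<Sum>(i, j)\<in>offdiag n. gauss_centered p0 \<nu> (X i) (X j)) =
       (\<Sum>(i, j)\<in>offdiag n. k (X i) (X j)) + (\<Sum>(i, j)\<in>offdiag n. u (X i)) + (\<Sum>(i, j)\<in>offdiag n. u (X j)) + (\<Sum>(i, j)\<in>offdiag n. \<theta>)"
      unfolding centered by (simp add: split_def sum.distrib)
    also have "(\<Sum>(i, j)\<in>offdiag n. \<theta>) = real n * (real n - 1) * \<theta>"
      by (simp add: split_def card_offdiag)
    finally have "(\<Sum>(i, j)\<in>offdiag n. gauss_centered p0 \<nu> (X i) (X j)) =
       (\<Sum>(i, j)\<in>offdiag n. k (X i) (X j)) + 2 * (real n - 1) * (\<Sum>i<n. u (X i)) + real n * (real n - 1) * \<theta>"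
      unfolding sum_offdiag_fst[where g="\<lambda>i. u (X i)"] sum_offdiag_snd[where g="\<lambda>i. u (X i)"] by simp
    note sums = this
    have alg: "1 / (N * m) * (A + 2 * m * U + N * m * \<theta>) = \<theta> + 2 * (U / N) + A / (N * m)"
      if "N \<noteq> 0" "m \<noteq> 0" for N m A U :: real
      using that by (simp add: field_simps)
    show ?thesis
      unfolding gamma2_hat_def offdiag_def[symmetric] Y_def W_def sums using n by (intro alg) auto
  qed
  have reject: "T_GOF p0 n \<nu> X > z" if "V X < 1" for X
  proof -
    have S0: "0 \<le> S X - 1 / (real n)\<^sup>2"
      unfolding S_def using nn n by (auto intro!: add_nonneg_nonneg mult_nonneg_nonneg divide_nonneg_nonneg sum_nonneg g01)
    have sh: "s_hat n \<nu> X > 0" using n unfolding s_hat_def by (simp add: less_max_iff_disj)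
    have "s2_tilde n \<nu> X \<le> S X - 1 / (real n)\<^sup>2" using s2_tilde_le[OF n \<nu>, of X] unfolding S_def by simp
    moreover have "0 \<le> 1 / (real n)\<^sup>2" by simp
    ultimately have "max (s2_tilde n \<nu> X) (1 / (real n)\<^sup>2) \<le> S X" using S0 by (intro max.boundedI) linarith+
    moreover have "(s_hat n \<nu> X)\<^sup>2 = max (s2_tilde n \<nu> X) (1 / (real n)\<^sup>2)"
      unfolding s_hat_def by (intro real_sqrt_pow2) (simp add: le_max_iff_disj)
    ultimately have "(s_hat n \<nu> X)\<^sup>2 \<le> S X" by simp
    from reject_if_close[OF n \<theta> gam sh this that[unfolded V_def]] show ?thesis unfolding T_GOF_def .
  qed
  have comp: "(\<lambda>X. X i) \<in> borel_measurable ?P" if "i < n" for i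
    using measurable_component_singleton[of i "{..<n}" "\<lambda>_. M"] that measurable_cong_sets[OF refl M(2), of ?P] by simp
  have pairm: "(\<lambda>X. gauss \<mu> (X i) (X j)) \<in> borel_measurable ?P" if "i < n" "j < n" for i j \<mu>
    by (intro gauss_measurable2 comp that)
  have pairk: "(\<lambda>X. k (X i) (X j)) \<in> borel_measurable ?P" if "i < n" "j < n" for i j
  proof -
    have "(\<lambda>X. b (X i)) \<in> borel_measurable ?P" "(\<lambda>X. b (X j)) \<in> borel_measurable ?P"
      using that by (auto intro!: measurable_compose[OF comp])
    then show ?thesis using pairm[OF that] unfolding k_def by measurable
  qed
  have singleu: "(\<lambda>X. u (X i)) \<in> borel_measurable ?P" if "i < n" for i
    using that um by (auto intro!: measurable_compose[OF comp])
  have Ym [measurable]: "Y \<in> borel_measurable ?P" unfolding Y_def[abs_def]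
    by (intro borel_measurable_divide borel_measurable_sum) (auto intro!: singleu)
  have Wm [measurable]: "W \<in> borel_measurable ?P" unfolding W_def[abs_def]
    by (intro borel_measurable_divide borel_measurable_sum) (auto simp: offdiag_def split_def intro!: pairk)
  have Sm [measurable]: "S \<in> borel_measurable ?P" unfolding S_def[abs_def]
    by (intro borel_measurable_add borel_measurable_times borel_measurable_sum) (auto simp: offdiag_def split_def intro!: pairm)
  have Vm [measurable]: "V \<in> borel_measurable ?P" unfolding V_def[abs_def] by measurable
  have EY: "integrable ?P (\<lambda>X. (Y X)\<^sup>2)" "(LINT X|?P. (Y X)\<^sup>2) \<le> q / real n"
  proof -
    have "\<bar>\<Sum>i<n. u (X i)\<bar> \<le> real n * 2" for X
    proof -
      have "(\<Sum>i<n. \<bar>u (X i)\<bar>) \<le> real (card {..<n}) * 2" by (rule sum_bounded_above) (rule u2)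
      then show ?thesis using order_trans[OF sum_abs] by simp
    qed
    then have "\<bar>Y X\<bar> \<le> 2" for X using n unfolding Y_def by (simp add: divide_le_eq mult.commute)
    then have "\<bar>(Y X)\<^sup>2\<bar> \<le> 4" for X using power_mono[of "\<bar>Y X\<bar>" 2 2] by simp
    then show "integrable ?P (\<lambda>X. (Y X)\<^sup>2)" by (intro M.integrable_PiM_bounded[where B=4]) measurable
    have "(LINT X|?P. (Y X)\<^sup>2) = (LINT X|?P. (\<Sum>i<n. u (X i))\<^sup>2) / (real n)\<^sup>2"
      unfolding Y_def power_divide by simp
    also have "\<dots> = (LINT x|M. (u x)\<^sup>2) / real n"
      using n by (subst M.second_moment_sum[OF _ u2 u0]) (auto simp: power2_eq_square)
    also have "\<dots> \<le> q / real n" using uu n by (simp add: divide_right_mono)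
    finally show "(LINT X|?P. (Y X)\<^sup>2) \<le> q / real n" .
  qed
  have EW: "integrable ?P (\<lambda>X. (W X)\<^sup>2)" "(LINT X|?P. (W X)\<^sup>2) \<le> 64 * e / (real n)\<^sup>2"
  proof -
    have "\<bar>\<Sum>(i, j)\<in>offdiag n. k (X i) (X j)\<bar> \<le> real n * (real n - 1) * 4" for X
    proof -
      have "(\<Sum>a\<in>offdiag n. \<bar>case a of (i, j) \<Rightarrow> k (X i) (X j)\<bar>) \<le> real (card (offdiag n)) * 4"
        by (rule sum_bounded_above) (auto simp: k4 split_def)
      then show ?thesis using sum_abs[of "\<lambda>(i, j). k (X i) (X j)" "offdiag n"] unfolding card_offdiag by linarith
    qed
    then have "\<bar>W X\<bar> \<le> 4" for X using nn unfolding W_def by (simp add: divide_le_eq mult.commute)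
    then have "\<bar>(W X)\<^sup>2\<bar> \<le> 16" for X using power_mono[of "\<bar>W X\<bar>" 4 2] by simp
    then show "integrable ?P (\<lambda>X. (W X)\<^sup>2)" by (intro M.integrable_PiM_bounded[where B=16]) measurable
    have "(LINT X|?P. (W X)\<^sup>2) = (LINT X|?P. (\<Sum>(i, j)\<in>offdiag n. k (X i) (X j))\<^sup>2) / (real n * (real n - 1))\<^sup>2"
      unfolding W_def power_divide by simp
    also have "\<dots> = 2 * (LINT y|M. LINT x|M. (k x y)\<^sup>2) / (real n * (real n - 1))"
      using nn by (subst M.second_moment_degenerate[OF km k4 ksym k0]) (auto simp: power2_eq_square)
    also have "\<dots> \<le> 2 * (16 * e) / (real n * (real n - 1))" using kk nn by (intro divide_right_mono) auto
    also have "\<dots> \<le> 2 * (16 * e) / ((real n)\<^sup>2 / 2)"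
      using nn n e01 by (intro divide_left_mono) (auto simp: power2_eq_square field_simps)
    finally show "(LINT X|?P. (W X)\<^sup>2) \<le> 64 * e / (real n)\<^sup>2" by simp
  qed
  have Eg: "(LINT X|?P. gauss \<nu> (X i) (X j)) = e" if "i < n" "j < n" "i \<noteq> j" for i j
  proof -
    have "(\<lambda>z. gauss \<nu> (fst z) (snd z)) \<in> borel_measurable (M \<Otimes>\<^sub>M M)" by measurable
    from M.integral_PiM_pair[OF _ _ _ that(3) this g01(3), of "{..<n}"] that show ?thesis
      by (simp add: e_def gauss_commute)
  qed
  have igg: "integrable ?P (\<lambda>X. gauss \<nu> (X i) (X j))" if "i < n" "j < n" for i j
    by (rule M.integrable_PiM_bounded[OF pairm[OF that] g01(3)])
  have ES: "integrable ?P S" "(LINT X|?P. S X) \<le> 17 * e + 1 / (real n)\<^sup>2"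
  proof -
    have i1: "integrable ?P (\<lambda>X. \<Sum>(i, j)\<in>offdiag n. gauss \<nu> (X i) (X j))"
      by (rule Bochner_Integration.integrable_sum) (auto simp: offdiag_def intro!: igg)
    have i2: "integrable ?P (\<lambda>X. \<Sum>(i1, i2, j1, j2)\<in>?Q. gauss \<nu> (X i1) (X j1))"
      by (rule Bochner_Integration.integrable_sum) (auto intro!: igg)
    show "integrable ?P S" unfolding S_def[abs_def] using i1 i2 by simp
    have 1: "(LINT X|?P. (\<Sum>(i, j)\<in>offdiag n. gauss \<nu> (X i) (X j))) = real n * (real n - 1) * e"
    proof -
      have "(LINT X|?P. (\<Sum>(i, j)\<in>offdiag n. gauss \<nu> (X i) (X j))) = (\<Sum>a\<in>offdiag n. (LINT X|?P. gauss \<nu> (X (fst a)) (X (snd a))))"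
        unfolding split_def by (rule Bochner_Integration.integral_sum) (auto simp: offdiag_def intro!: igg)
      also have "\<dots> = (\<Sum>a\<in>offdiag n. e)" by (intro sum.cong) (auto simp: offdiag_def Eg)
      finally show ?thesis by (simp add: card_offdiag)
    qed
    have 2: "(LINT X|?P. (\<Sum>(i1, i2, j1, j2)\<in>?Q. gauss \<nu> (X i1) (X j1))) = real (card ?Q) * e"
    proof -
      have "(LINT X|?P. (\<Sum>(i1, i2, j1, j2)\<in>?Q. gauss \<nu> (X i1) (X j1))) = (\<Sum>a\<in>?Q. (LINT X|?P. (case a of (i1, i2, j1, j2) \<Rightarrow> gauss \<nu> (X i1) (X j1))))"
        by (rule Bochner_Integration.integral_sum) (auto intro!: igg)
      also have "\<dots> = (\<Sum>a\<in>?Q. e)" by (intro sum.cong) (auto intro!: Eg dest!: card_4_distinct)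
      finally show ?thesis by simp
    qed
    have "(LINT X|?P. S X) = 1 / (real n * (real n - 1)) * (real n * (real n - 1) * e) + fact (n - 4) / fact n * (real (card ?Q) * e) + 1 / (real n)\<^sup>2"
    proof -
      have "(LINT X|?P. r1 * A X + r2 * C X + r3) = r1 * integral\<^sup>L ?P A + r2 * integral\<^sup>L ?P C + r3"
        if "integrable ?P A" "integrable ?P C" for r1 r2 r3 and A C :: "(nat \<Rightarrow> 'a) \<Rightarrow> real"
        using that by (simp add: P.prob_space)
      from this[OF i1 i2] show ?thesis unfolding S_def 1 2 .
    qed
    also have "\<dots> = e + (fact (n - 4) / fact n * real (card ?Q)) * e + 1 / (real n)\<^sup>2"
      using less_imp_neq[OF nn] by simp
    also have "\<dots> \<le> e + 16 * e + 1 / (real n)\<^sup>2"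
      using mult_right_mono[OF distinct_quadruples_weight[OF n] e01(1)] by linarith
    finally show "(LINT X|?P. S X) \<le> 17 * e + 1 / (real n)\<^sup>2" by simp
  qed
  have iV: "integrable ?P V" unfolding V_def[abs_def] using EY(1) EW(1) ES(1) by simp
  have "(LINT X|?P. V X) = 64 * (LINT X|?P. (Y X)\<^sup>2) / \<theta>\<^sup>2 + 16 * (LINT X|?P. (W X)\<^sup>2) / \<theta>\<^sup>2 + 8 * (z\<^sup>2 + 1) * (LINT X|?P. S X) / ((real n)\<^sup>2 * \<theta>\<^sup>2)"
    unfolding V_def using EY(1) EW(1) ES(1) by simp
  also have "\<dots> \<le> 64 * (q / real n) / \<theta>\<^sup>2 + 16 * (64 * e / (real n)\<^sup>2) / \<theta>\<^sup>2 + 8 * (z\<^sup>2 + 1) * (17 * e + 1 / (real n)\<^sup>2) / ((real n)\<^sup>2 * \<theta>\<^sup>2)"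
    using EY(2) EW(2) ES(2) by (intro add_mono divide_right_mono mult_left_mono) auto
  also have "\<dots> = 64 * q / (real n * \<theta>\<^sup>2) + 1024 * e / ((real n)\<^sup>2 * \<theta>\<^sup>2)
            + 8 * (z\<^sup>2 + 1) * (17 * e + 1 / (real n)\<^sup>2) / ((real n)\<^sup>2 * \<theta>\<^sup>2)" by simp
  finally have EV: "(LINT X|?P. V X) \<le> \<dots>" .
  have V0: "0 \<le> V X" for X
  proof -
    have "0 \<le> S X" unfolding S_def using nn n by (auto intro!: add_nonneg_nonneg mult_nonneg_nonneg divide_nonneg_nonneg sum_nonneg g01)
    then show ?thesis unfolding V_def by (intro add_nonneg_nonneg divide_nonneg_nonneg mult_nonneg_nonneg) auto
  qed
  have markov: "P.prob {X \<in> space ?P. V X \<ge> 1} \<le> (LINT X|?P. V X)"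
    using integral_Markov_inequality_measure[OF iV sets.empty_sets, of 1] V0 by simp
  have Tm: "{X \<in> space ?P. T_GOF p0 n \<nu> X > z} \<in> sets ?P"
  proof -
    have g2: "gamma2_hat p0 n \<nu> \<in> borel_measurable ?P" unfolding gam[abs_def] by measurable
    have s2: "s2_tilde n \<nu> \<in> borel_measurable ?P"
      unfolding s2_tilde_def[abs_def]
      by (intro borel_measurable_add borel_measurable_diff borel_measurable_times borel_measurable_sum) (auto simp: split_def intro!: borel_measurable_times pairm)
    have "T_GOF p0 n \<nu> \<in> borel_measurable ?P"
      unfolding T_GOF_def[abs_def] s_hat_def using g2 s2 by measurable
    then show ?thesis by measurable
  qed
  have "1 - P.prob {X \<in> space ?P. V X \<ge> 1} = P.prob {X \<in> space ?P. V X < 1}"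
  proof -
    have "{X \<in> space ?P. V X < 1} = space ?P - {X \<in> space ?P. V X \<ge> 1}" by auto
    then show ?thesis by (simp add: P.prob_compl)
  qed
  also have "\<dots> \<le> P.prob {X \<in> space ?P. T_GOF p0 n \<nu> X > z}"
    using reject by (intro P.finite_measure_mono Tm) auto
  finally show ?thesis using markov EV by linarith
qed

section \<open>Uniform bounds over the alternative\<close>

lemma fourier_cong_AE:
  fixes f g :: "'a::euclidean_space \<Rightarrow> real"
  assumes "f \<in> borel_measurable lebesgue" "g \<in> borel_measurable lebesgue" "AE x in lebesgue. f x = g x"
  shows "fourier f = fourier g"
proof
  fix w :: 'a
  have [measurable]: "(\<lambda>x. exp (- (\<i> * complex_of_real (x \<bullet> w)))) \<in> borel_measurable lebesgue"
    by (rule measurable_completion) measurable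
  note [measurable] = assms(1,2)
  have "(LINT x|lebesgue. of_real (f x) * exp (- (\<i> * complex_of_real (x \<bullet> w)))) = (LINT x|lebesgue. of_real (g x) * exp (- (\<i> * complex_of_real (x \<bullet> w))))"
    using assms(3) by (intro integral_cong_AE) auto
  then show "fourier f w = fourier g w" by (simp add: fourier_def)
qed

lemma fourier_diff:
  fixes f g :: "'a::euclidean_space \<Rightarrow> real"
  assumes [measurable]: "f \<in> borel_measurable borel" "g \<in> borel_measurable borel" and i: "integrable lborel f" "integrable lborel g"
  shows "fourier (\<lambda>x. f x - g x) w = fourier f w - fourier g w"
proof -
  have int: "integrable lborel (\<lambda>x. complex_of_real (h x) * iexp (- (w \<bullet> x)))" if "integrable lborel h" for h :: "'a \<Rightarrow> real"
    by (rule Bochner_Integration.integrable_bound[OF that]) (use that in \<open>auto simp: norm_mult\<close>)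
  show ?thesis
    by (simp add: fourier_borel of_real_diff left_diff_distrib right_diff_distrib
      Bochner_Integration.integral_diff[OF int[OF i(1)] int[OF i(2)]] del: of_real_minus)
qed

text \<open>
A density here is only Lebesgue measurable, while Fubini's theorem is applied to product Borel measures.
The Fourier transform and the law do not see the passage to a Borel version.
\<close>

lemma density_borel_version:
  fixes p :: "'a::euclidean_space \<Rightarrow> real"
  assumes "prob_density p"
  obtains p' where "p' \<in> borel_measurable borel" "\<And>x. 0 \<le> p' x" "AE x in lborel. p x = p' x"
    "integrable lborel p'" "law p = density lborel (\<lambda>x. ennreal (p' x))" "prob_space (law p)" "fourier p = fourier p'"
proof -
  from assms have int: "integrable lebesgue p" and nonneg: "\<And>x. 0 \<le> p x" and one: "(LINT x|lebesgue. p x) = 1"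
    by (auto simp: prob_density_def)
  have pm [measurable]: "p \<in> borel_measurable lebesgue" using int by auto
  obtain g where g: "g \<in> borel_measurable lborel" "AE x in lborel. p x = g x"
    using completion_ex_borel_measurable_real[OF pm] by auto
  define p' where "p' x = max 0 (g x)" for x
  have p'm [measurable]: "p' \<in> borel_measurable borel" using g(1) unfolding p'_def[abs_def] by simp
  have p'm': "p' \<in> borel_measurable lebesgue" by (rule measurable_completion) simp
  have ae: "AE x in lborel. p x = p' x"
    using g(2) by eventually_elim (metis nonneg p'_def max.absorb2)
  have ae': "AE x in lebesgue. p x = p' x" using ae by (rule AE_completion)
  have "integrable lebesgue p'" using integrable_cong_AE[OF pm p'm' ae'] int by simp
  then have int': "integrable lborel p'" by (subst (asm) integrable_completion) auto
  have em: "emeasure (law p) A = emeasure (density lborel (\<lambda>x. ennreal (p' x))) A" if A: "A \<in> sets borel" for A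
  proof -
    have id: "(\<lambda>x. x) \<in> measurable (density lebesgue (\<lambda>x. ennreal (p x))) (borel :: 'a measure)"
      by (auto simp: measurable_def)
    have Al: "A \<in> sets lebesgue" using A by auto
    have "emeasure (law p) A = emeasure (density lebesgue (\<lambda>x. ennreal (p x))) A"
      unfolding law_def using A by (subst emeasure_distr[OF id]) auto
    also have "\<dots> = (\<integral>\<^sup>+x. ennreal (p x) * indicator A x \<partial>lebesgue)"
      using Al by (subst emeasure_density) auto
    also have "\<dots> = (\<integral>\<^sup>+x. ennreal (p x) * indicator A x \<partial>lborel)" by (rule nn_integral_completion)
    also have "\<dots> = (\<integral>\<^sup>+x. ennreal (p' x) * indicator A x \<partial>lborel)"
      using ae by (intro nn_integral_cong_AE) auto
    also have "\<dots> = emeasure (density lborel (\<lambda>x. ennreal (p' x))) A"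
      using A by (subst emeasure_density) auto
    finally show ?thesis .
  qed
  have law: "law p = density lborel (\<lambda>x. ennreal (p' x))"
    by (rule measure_eqI) (use em in \<open>auto simp: law_def\<close>)
  have "(LINT x|lborel. p' x) = (LINT x|lebesgue. p' x)" by (rule integral_completion[symmetric]) simp
  also have "\<dots> = 1" using one integral_cong_AE[OF pm p'm' ae'] by simp
  finally have one': "(LINT x|lborel. p' x) = 1" .
  have "prob_space (law p)"
  proof
    have "emeasure (law p) (space (law p)) = (\<integral>\<^sup>+x. ennreal (p' x) \<partial>lborel)"
      unfolding law by (subst emeasure_density) auto
    also have "\<dots> = 1" using nn_integral_eq_integral[OF int'] one' by (simp add: p'_def)
    finally show "emeasure (law p) (space (law p)) = 1" .
  qed
  moreover have "0 \<le> p' x" for x by (simp add: p'_def)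
  ultimately show ?thesis
    using that[OF p'm _ ae int' law _ fourier_cong_AE[OF pm p'm' ae']] by blast
qed

text \<open>
The number K is the squared L2 norm of the Fourier transform of p - p0. It is used in place of the squared L2 norm
of p - p0 itself because the signal and the noise are both naturally bounded in terms of it,
so that the single inequality K \<ge> \<Delta>^2 links them to the separation.
\<close>

lemma alternative_moment_bounds:
  fixes p p0 :: "'a::euclidean_space \<Rightarrow> real"
  assumes s: "s > 0" and M: "M > 0" and p0: "prob_density p0" "p0 \<in> sobolev s"
    and p: "p \<in> H1_GOF p0 M s \<Delta>" and \<Delta>: "\<Delta> > 0" and \<nu>: "\<nu> > 0"
  defines "\<phi> \<equiv> \<lambda>x. (LINT u|law p. gauss \<nu> x u) - (LINT u|law p0. gauss \<nu> x u)"
  shows "\<exists>K\<ge>\<Delta>\<^sup>2.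
     exp (-1/4) * (pi / \<nu>) powr (real DIM('a) / 2) * (K - \<nu> powr (-s) * (2 * M\<^sup>2 + 2 * (sobolev_norm s p0)\<^sup>2))
        \<le> (LINT x|law p. \<phi> x) - (LINT x|law p0. \<phi> x)
     \<and> (LINT x|law p. (\<phi> x)\<^sup>2) \<le> M * K * (pi / \<nu>) powr (3 * real DIM('a) / 4)
     \<and> (LINT x|law p. LINT u|law p. gauss \<nu> x u) \<le> (pi / \<nu>) powr (real DIM('a) / 2) * M\<^sup>2"
proof -
  have pp: "prob_density p" "p \<in> sobolev s" "sobolev_norm s p \<le> M" "L2_norm (\<lambda>x. p x - p0 x) \<ge> \<Delta>"
    using p by (auto simp: H1_GOF_def sobolev_ball_def)
  obtain g where g [measurable]: "g \<in> borel_measurable borel" and g0: "\<And>x. 0 \<le> g x" and gae: "AE x in lborel. p x = g x"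
    and ig: "integrable lborel g" and lawp: "law p = density lborel (\<lambda>x. ennreal (g x))" and fg: "fourier p = fourier g"
    using density_borel_version[OF pp(1)] by metis
  obtain h where h [measurable]: "h \<in> borel_measurable borel" and h0: "\<And>x. 0 \<le> h x" and hae: "AE x in lborel. p0 x = h x"
    and ih: "integrable lborel h" and lawp0: "law p0 = density lborel (\<lambda>x. ennreal (h x))" and fh: "fourier p0 = fourier h"
    using density_borel_version[OF p0(1)] by metis
  define f where "f x = g x - h x" for x
  have f [measurable]: "f \<in> borel_measurable borel" unfolding f_def[abs_def] by measurable
  have intf: "integrable lborel f" unfolding f_def[abs_def] using ig ih by simp
  have fae: "AE x in lborel. p x - p0 x = f x" using gae hae by eventually_elim (simp add: f_def)
  have ff: "fourier f w = fourier g w - fourier h w" for w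
    unfolding f_def[abs_def] by (rule fourier_diff[OF g h ig ih])
  note [measurable] = fourier_measurable[OF g] fourier_measurable[OF h] fourier_measurable[OF f]
  have Wm: "sobolev_weighted s k \<in> borel_measurable borel" if "fourier k \<in> borel_measurable borel" for k :: "'a \<Rightarrow> real"
    using that unfolding sobolev_weighted_def[abs_def] by measurable
  have Weq: "sobolev_weighted s p = sobolev_weighted s g" "sobolev_weighted s p0 = sobolev_weighted s h"
    by (auto simp: sobolev_weighted_def[abs_def] fg fh)
  have iWl: "integrable lebesgue (sobolev_weighted s g)" "integrable lebesgue (sobolev_weighted s h)"
    using pp(2) p0(2) by (simp_all add: sobolev_def flip: Weq)
  have Wg: "integrable lborel (sobolev_weighted s g)" and Wh: "integrable lborel (sobolev_weighted s h)"
    using iWl Wm[OF fourier_measurable[OF g]] Wm[OF fourier_measurable[OF h]] by (auto simp: integrable_completion)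
  have W0: "0 \<le> sobolev_weighted s k w" for k w unfolding sobolev_weighted_def by simp
  have W1: "0 \<le> integral\<^sup>L lborel (sobolev_weighted s k)" for k :: "'a \<Rightarrow> real"
    by (rule Bochner_Integration.integral_nonneg) (rule W0)
  have norm: "(sobolev_norm s p)\<^sup>2 = (LINT w|lborel. sobolev_weighted s g w)" "(sobolev_norm s p0)\<^sup>2 = (LINT w|lborel. sobolev_weighted s h w)"
    unfolding sobolev_norm_def Weq using Wm[OF fourier_measurable[OF g]] Wm[OF fourier_measurable[OF h]] W1
    by (simp_all add: integral_completion)
  have "0 \<le> sobolev_norm s p"
    unfolding sobolev_norm_def
    by (intro real_sqrt_ge_zero Bochner_Integration.integral_nonneg) (rule W0)
  then have gM: "(LINT w|lborel. sobolev_weighted s g w) \<le> M\<^sup>2"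
    unfolding norm(1)[symmetric] using pp(3) by (intro power_mono)
  have Wle: "sobolev_weighted s f w \<le> 2 * sobolev_weighted s g w + 2 * sobolev_weighted s h w" for w
  proof -
    have "(cmod (fourier f w))\<^sup>2 \<le> (cmod (fourier g w) + cmod (fourier h w))\<^sup>2"
      unfolding ff by (intro power_mono norm_triangle_ineq4) simp
    also have "\<dots> \<le> 2 * (cmod (fourier g w))\<^sup>2 + 2 * (cmod (fourier h w))\<^sup>2"
      using sum_squares_bound[of "cmod (fourier g w)" "cmod (fourier h w)"] by (simp add: power2_sum)
    finally have "(1 + (norm w)\<^sup>2) powr s * (cmod (fourier f w))\<^sup>2 \<le> (1 + (norm w)\<^sup>2) powr s * (2 * (cmod (fourier g w))\<^sup>2 + 2 * (cmod (fourier h w))\<^sup>2)"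
      by (rule mult_left_mono) simp
    then show ?thesis unfolding sobolev_weighted_def by (simp add: distrib_left)
  qed
  have iWf: "integrable lborel (sobolev_weighted s f)"
  proof (rule Bochner_Integration.integrable_bound)
    show "integrable lborel (\<lambda>w. 2 * sobolev_weighted s g w + 2 * sobolev_weighted s h w)" using Wg Wh by simp
    show "sobolev_weighted s f \<in> borel_measurable lborel" using Wm[OF fourier_measurable[OF f]] by simp
    show "AE w in lborel. norm (sobolev_weighted s f w) \<le> norm (2 * sobolev_weighted s g w + 2 * sobolev_weighted s h w)"
      using order_trans[OF Wle abs_ge_self] by (simp add: abs_of_nonneg[OF W0])
  qed
  have fW: "(LINT w|lborel. sobolev_weighted s f w) \<le> 2 * M\<^sup>2 + 2 * (sobolev_norm s p0)\<^sup>2"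
  proof -
    have "(LINT w|lborel. sobolev_weighted s f w) \<le> (LINT w|lborel. 2 * sobolev_weighted s g w + 2 * sobolev_weighted s h w)"
      using iWf Wg Wh Wle by (intro integral_mono) auto
    also have "\<dots> = 2 * (LINT w|lborel. sobolev_weighted s g w) + 2 * (LINT w|lborel. sobolev_weighted s h w)" using Wg Wh by simp
    finally show ?thesis using gM unfolding norm by linarith
  qed
  note Fg = gauss_form_sobolev_bounds[OF g ig \<nu> s Wg]
  note Ff = gauss_form_sobolev_bounds[OF f intf \<nu> s iWf]
  define K where "K = (LINT w|lborel. (cmod (fourier f w))\<^sup>2)"
  have contp: "AE x in lborel. isCont p x" and contp0: "AE x in lborel. isCont p0 x"
    using pp(2) p0(2) unfolding sobolev_def by (auto simp: AE_completion_iff)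
  have contf: "AE x in lborel. isCont (\<lambda>x. p x - p0 x) x"
    using contp contp0 by eventually_elim (intro continuous_intros)
  note f2 = L2_le_fourier_L2[OF f intf fae contf Ff(1)]
  note g2 = L2_le_fourier_L2[OF g ig gae contp Fg(1)]
  have \<Delta>K: "\<Delta>\<^sup>2 \<le> K"
  proof -
    have "(LINT x|lebesgue. (p x - p0 x)\<^sup>2) = (LINT x|lebesgue. (f x)\<^sup>2)"
    proof (rule integral_cong_AE)
      have "p \<in> borel_measurable lebesgue" "p0 \<in> borel_measurable lebesgue"
        using pp(1) p0(1) by (auto simp: prob_density_def)
      then show "(\<lambda>x. (p x - p0 x)\<^sup>2) \<in> borel_measurable lebesgue" by measurable
      show "(\<lambda>x. (f x)\<^sup>2) \<in> borel_measurable lebesgue" by (rule measurable_completion) measurable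
      show "AE x in lebesgue. (p x - p0 x)\<^sup>2 = (f x)\<^sup>2"
        by (rule AE_completion) (use fae in eventually_elim, simp)
    qed
    also have "\<dots> = (LINT x|lborel. (f x)\<^sup>2)" by (rule integral_completion) measurable
    finally have eq: "L2_norm (\<lambda>x. p x - p0 x) = sqrt (LINT x|lborel. (f x)\<^sup>2)" by (simp add: L2_norm_def)
    have "\<Delta>\<^sup>2 \<le> (sqrt (LINT x|lborel. (f x)\<^sup>2))\<^sup>2"
      using pp(4) \<Delta> unfolding eq by (intro power_mono) auto
    also have "\<dots> = (LINT x|lborel. (f x)\<^sup>2)" by simp
    also have "\<dots> \<le> K" using f2(2) unfolding K_def .
    finally show ?thesis .
  qed
  have Ip: "(LINT x|law p. k x) = (LINT x|lborel. g x * k x)" if "k \<in> borel_measurable borel" for k :: "'a \<Rightarrow> real"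
    unfolding lawp using that g0 by (subst integral_density) auto
  have Ip0: "(LINT x|law p0. k x) = (LINT x|lborel. h x * k x)" if "k \<in> borel_measurable borel" for k :: "'a \<Rightarrow> real"
    unfolding lawp0 using that h0 by (subst integral_density) auto
  have b: "(LINT u|law p. gauss \<nu> x u) = gauss_conv \<nu> g x" and a: "(LINT u|law p0. gauss \<nu> x u) = gauss_conv \<nu> h x" for x
    unfolding gauss_conv_def by (subst Ip Ip0; simp add: mult.commute)+
  have igk: "integrable lborel (\<lambda>y. gauss \<nu> x y * g y)" "integrable lborel (\<lambda>y. gauss \<nu> x y * h y)" for x
    using integrable_gauss_mult[OF ig] integrable_gauss_mult[OF ih] \<nu> by auto
  have \<phi>: "\<phi> = gauss_conv \<nu> f"
    unfolding \<phi>_def a b unfolding gauss_conv_def[abs_def] f_def right_diff_distrib using igk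
    by (simp add: Bochner_Integration.integral_diff)
  have form: "(LINT z|(lborel \<Otimes>\<^sub>M lborel). gauss \<nu> (fst z) (snd z) * (k (fst z) * k (snd z))) = (LINT x|lborel. k x * gauss_conv \<nu> k x)"
    "integrable lborel (\<lambda>x. k x * gauss_conv \<nu> l x)"
    if k: "integrable lborel k" and l: "integrable lborel l" for k l :: "'a \<Rightarrow> real"
  proof -
    note iT = integrable_gauss_tensor[OF k, of _ \<nu>]
    have "(LINT z|(lborel \<Otimes>\<^sub>M lborel). gauss \<nu> (fst z) (snd z) * (k (fst z) * k (snd z))) = (LINT x|lborel. LINT y|lborel. gauss \<nu> x y * (k x * k y))"
      using lborel_pair.integral_fst'[OF iT[OF k]] \<nu> by simp
    also have "\<dots> = (LINT x|lborel. k x * gauss_conv \<nu> k x)"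
      unfolding gauss_conv_def by (simp add: mult.left_commute[of "gauss _ _ _"])
    finally show "(LINT z|(lborel \<Otimes>\<^sub>M lborel). gauss \<nu> (fst z) (snd z) * (k (fst z) * k (snd z))) = (LINT x|lborel. k x * gauss_conv \<nu> k x)" .
    have "integrable lborel (\<lambda>x. LINT y|lborel. gauss \<nu> x y * (k x * l y))"
      using lborel_pair.integrable_fst'[OF iT[OF l]] \<nu> by simp
    then show "integrable lborel (\<lambda>x. k x * gauss_conv \<nu> l x)"
      unfolding gauss_conv_def by (simp add: mult.left_commute[of "gauss _ _ _"])
  qed
  have "(LINT x|law p. \<phi> x) - (LINT x|law p0. \<phi> x) = (LINT x|lborel. g x * gauss_conv \<nu> f x) - (LINT x|lborel. h x * gauss_conv \<nu> f x)"
    unfolding \<phi> by (simp add: Ip Ip0)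
  also have "\<dots> = (LINT x|lborel. f x * gauss_conv \<nu> f x)"
    unfolding f_def[of x for x] left_diff_distrib using form(2)[OF ig intf] form(2)[OF ih intf]
    by (subst Bochner_Integration.integral_diff) (auto simp: f_def[abs_def])
  finally have th: "(LINT x|law p. \<phi> x) - (LINT x|law p0. \<phi> x) = (LINT z|(lborel \<Otimes>\<^sub>M lborel). gauss \<nu> (fst z) (snd z) * (f (fst z) * f (snd z)))"
    by (simp add: form(1)[OF intf intf])
  have "exp (-1/4) * (pi / \<nu>) powr (real DIM('a) / 2) * (K - \<nu> powr (-s) * (2 * M\<^sup>2 + 2 * (sobolev_norm s p0)\<^sup>2))
     \<le> exp (-1/4) * (pi / \<nu>) powr (real DIM('a) / 2) * (K - \<nu> powr (-s) * (LINT w|lborel. sobolev_weighted s f w))"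
    by (intro mult_left_mono diff_left_mono fW) auto
  also have "\<dots> \<le> (LINT x|law p. \<phi> x) - (LINT x|law p0. \<phi> x)" unfolding th K_def by (rule Ff(3))
  finally have 1: "exp (-1/4) * (pi / \<nu>) powr (real DIM('a) / 2) * (K - \<nu> powr (-s) * (2 * M\<^sup>2 + 2 * (sobolev_norm s p0)\<^sup>2))
     \<le> (LINT x|law p. \<phi> x) - (LINT x|law p0. \<phi> x)" .
  have "(LINT x|law p. (\<phi> x)\<^sup>2) = (LINT x|lborel. (gauss_conv \<nu> f x)\<^sup>2 * g x)"
    unfolding \<phi> by (simp add: Ip mult.commute)
  also have "\<dots> \<le> M * K * (pi / \<nu>) powr (3 * real DIM('a) / 4)"
    using f2(2) gauss_conv_L2_le[OF f intf \<nu> Ff(1)] order_trans[OF g2(2) order_trans[OF Fg(2) gM]] M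
    unfolding K_def by (intro gauss_conv_weighted_L2[OF f intf \<nu> f2(1) g g2(1)]) auto
  finally have 2: "(LINT x|law p. (\<phi> x)\<^sup>2) \<le> M * K * (pi / \<nu>) powr (3 * real DIM('a) / 4)" .
  have "(LINT x|law p. LINT u|law p. gauss \<nu> x u) = (LINT x|lborel. g x * gauss_conv \<nu> g x)"
    unfolding b by (simp add: Ip)
  also have "\<dots> \<le> (pi / \<nu>) powr (real DIM('a) / 2) * M\<^sup>2"
    using Fg(4) mult_left_mono[OF gM, of "(pi / \<nu>) powr (real DIM('a) / 2)"] unfolding form(1)[OF ig ig] by simp
  finally have 3: "(LINT x|law p. LINT u|law p. gauss \<nu> x u) \<le> (pi / \<nu>) powr (real DIM('a) / 2) * M\<^sup>2" .
  show ?thesis using \<Delta>K 1 2 3 by blast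
qed

text \<open>
In the application x = (pi/\<nu>)^(D/4), so that r is \<nu>^(D/4) / (n K) up to a constant. The hypothesis with B says
that \<nu>^(D/2) is at most of order n^2; it makes the truncation level 1/n^2 of the variance estimator harmless.
\<close>

lemma error_le_rate:
  fixes N x K a M \<theta> q e z B :: real
  assumes pos: "N > 0" "x > 0" "K > 0" "a > 0" and \<theta>: "\<theta> \<ge> a * x\<^sup>2 * K"
    and q: "q \<le> M * K * x ^ 3" "q \<ge> 0" and e: "e \<le> M\<^sup>2 * x\<^sup>2" "e \<ge> 0" and B: "1 / (N\<^sup>2 * x\<^sup>2) \<le> B"
  defines "r \<equiv> 1 / (N * K * x)"
  shows "64 * q / (N * \<theta>\<^sup>2) + 1024 * e / (N\<^sup>2 * \<theta>\<^sup>2) + 8 * (z\<^sup>2 + 1) * (17 * e + 1 / N\<^sup>2) / (N\<^sup>2 * \<theta>\<^sup>2)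
     \<le> (64 * M / a\<^sup>2) * r + ((1024 * M\<^sup>2 + 8 * (z\<^sup>2 + 1) * (17 * M\<^sup>2 + B)) / a\<^sup>2) * r\<^sup>2"
proof -
  let ?t = "a * x\<^sup>2 * K"
  have t: "?t > 0" using pos by simp
  have T: "?t\<^sup>2 \<le> \<theta>\<^sup>2" using t \<theta> by (intro power_mono) auto
  have t2: "?t\<^sup>2 > 0" "\<theta>\<^sup>2 > 0" using t \<theta> by auto
  have z1: "z\<^sup>2 + 1 > 0" by (simp add: add_nonneg_pos)
  have "64 * q / (N * \<theta>\<^sup>2) \<le> 64 * (M * K * x ^ 3) / (N * ?t\<^sup>2)"
    using pos q T t2 by (intro frac_le mult_left_mono) auto
  also have "\<dots> = (64 * M / a\<^sup>2) * r"
    using pos by (simp add: r_def field_simps power2_eq_square power3_eq_cube)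
  finally have 1: "64 * q / (N * \<theta>\<^sup>2) \<le> (64 * M / a\<^sup>2) * r" .
  have "1024 * e / (N\<^sup>2 * \<theta>\<^sup>2) \<le> 1024 * (M\<^sup>2 * x\<^sup>2) / (N\<^sup>2 * ?t\<^sup>2)"
    using pos e T t2 by (intro frac_le mult_left_mono) auto
  also have "\<dots> = (1024 * M\<^sup>2 / a\<^sup>2) * r\<^sup>2"
    using pos by (simp add: r_def field_simps power2_eq_square)
  finally have 2: "1024 * e / (N\<^sup>2 * \<theta>\<^sup>2) \<le> (1024 * M\<^sup>2 / a\<^sup>2) * r\<^sup>2" .
  have "1 / N\<^sup>2 \<le> B * x\<^sup>2" using B pos by (simp add: divide_le_eq mult.commute mult.left_commute)
  then have le: "17 * e + 1 / N\<^sup>2 \<le> (17 * M\<^sup>2 + B) * x\<^sup>2" using e by (simp add: distrib_right)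
  have ge: "0 \<le> 17 * e + 1 / N\<^sup>2" using e by simp
  have B0: "0 \<le> B" using B by (rule order_trans[rotated]) simp
  have "8 * (z\<^sup>2 + 1) * (17 * e + 1 / N\<^sup>2) / (N\<^sup>2 * \<theta>\<^sup>2) \<le> 8 * (z\<^sup>2 + 1) * ((17 * M\<^sup>2 + B) * x\<^sup>2) / (N\<^sup>2 * ?t\<^sup>2)"
    using pos le ge T t2 z1 B0 by (intro frac_le mult_left_mono mult_nonneg_nonneg) auto
  also have "\<dots> = (8 * (z\<^sup>2 + 1) * (17 * M\<^sup>2 + B) / a\<^sup>2) * r\<^sup>2"
  proof -
    have "c * (d * x\<^sup>2) / (N\<^sup>2 * ?t\<^sup>2) = (c * d / a\<^sup>2) * r\<^sup>2" for c d :: real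
      using pos by (simp add: r_def field_simps power2_eq_square)
    then show ?thesis .
  qed
  finally have 3: "8 * (z\<^sup>2 + 1) * (17 * e + 1 / N\<^sup>2) / (N\<^sup>2 * \<theta>\<^sup>2) \<le> (8 * (z\<^sup>2 + 1) * (17 * M\<^sup>2 + B) / a\<^sup>2) * r\<^sup>2" .
  show ?thesis using 1 2 3 by (simp add: add_divide_distrib distrib_right)
qed

text \<open>
The bound depends on p only through the inequality K \<ge> \<Delta>^2, so it passes to the infimum over the alternative.
The assumption on \<nu>^(-s) says that at least half of the energy K survives the loss of high frequencies, whence the factor 1/2 in a.
\<close>

lemma test_power_bounds:
  fixes p0 :: "'a::euclidean_space \<Rightarrow> real"
  assumes s: "s > 0" and M: "M > 0" and p0: "prob_density p0" "p0 \<in> sobolev s"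
    and \<Delta>: "\<Delta> > 0" and \<nu>: "\<nu> > 0" and n: "n \<ge> 4"
    and small: "\<nu> powr (-s) * (2 * M\<^sup>2 + 2 * (sobolev_norm s p0)\<^sup>2) \<le> \<Delta>\<^sup>2 / 2"
    and B: "(\<nu> / pi) powr (real DIM('a) / 2) / (real n)\<^sup>2 \<le> B"
  defines "R \<equiv> (\<nu> / pi) powr (real DIM('a) / 4) / (real n * \<Delta>\<^sup>2)" and "a \<equiv> exp (-1/4) / 2"
  shows "1 - ((64 * M / a\<^sup>2) * R + ((1024 * M\<^sup>2 + 8 * ((z_upper \<alpha>)\<^sup>2 + 1) * (17 * M\<^sup>2 + B)) / a\<^sup>2) * R\<^sup>2)
     \<le> test_power n (Phi_GOF p0 n \<nu> \<alpha>) (H1_GOF p0 M s \<Delta>)"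
    and "test_power n (Phi_GOF p0 n \<nu> \<alpha>) (H1_GOF p0 M s \<Delta>) \<le> 1"
proof -
  let ?z = "z_upper \<alpha>"
  let ?A1 = "64 * M / a\<^sup>2" and ?A2 = "(1024 * M\<^sup>2 + 8 * (?z\<^sup>2 + 1) * (17 * M\<^sup>2 + B)) / a\<^sup>2"
  let ?H = "H1_GOF p0 M s \<Delta>"
  let ?pr = "\<lambda>p. measure (sample_law n p) {X \<in> space (sample_law n p). Phi_GOF p0 n \<nu> \<alpha> X}"
  have B0: "B \<ge> 0" using B by (rule order_trans[rotated]) simp
  have R0: "R \<ge> 0" unfolding R_def by simp
  have A0: "?A1 \<ge> 0" "?A2 \<ge> 0" using M B0 by auto
  have a0: "a > 0" by (simp add: a_def)
  have prob: "prob_space (law p)" if "prob_density p" for p :: "'a \<Rightarrow> real"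
    using density_borel_version[OF that] by metis
  have pr: "1 - (?A1 * R + ?A2 * R\<^sup>2) \<le> ?pr p" if p: "p \<in> ?H" for p
  proof -
    have pd: "prob_density p" using p by (simp add: H1_GOF_def)
    define \<phi> where "\<phi> x = (LINT u|law p. gauss \<nu> x u) - (LINT u|law p0. gauss \<nu> x u)" for x
    define \<theta> where "\<theta> = (LINT x|law p. \<phi> x) - (LINT x|law p0. \<phi> x)"
    define e where "e = (LINT x|law p. LINT u|law p. gauss \<nu> x u)"
    define q where "q = (LINT x|law p. (\<phi> x)\<^sup>2)"
    define x where "x = (pi / \<nu>) powr (real DIM('a) / 4)"
    have x0: "x > 0" unfolding x_def using \<nu> by simp
    have x2: "(pi / \<nu>) powr (real DIM('a) / 2) = x\<^sup>2"
      unfolding x_def power2_eq_square powr_add[symmetric] by simp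
    have x3: "(pi / \<nu>) powr (3 * real DIM('a) / 4) = x ^ 3"
      unfolding x_def power3_eq_cube powr_add[symmetric] by (simp add: field_simps)
    have inv: "(\<nu> / pi) powr t = 1 / (pi / \<nu>) powr t" for t
      using \<nu> by (simp add: powr_divide)
    obtain K where K: "K \<ge> \<Delta>\<^sup>2" and \<theta>K: "exp (-1/4) * x\<^sup>2 * (K - \<nu> powr (-s) * (2 * M\<^sup>2 + 2 * (sobolev_norm s p0)\<^sup>2)) \<le> \<theta>"
      and q: "q \<le> M * K * x ^ 3" and e: "e \<le> x\<^sup>2 * M\<^sup>2"
      using alternative_moment_bounds[OF s M p0 p \<Delta> \<nu>] unfolding \<theta>_def q_def e_def \<phi>_def x2 x3 by blast
    have K0: "K > 0" using K \<Delta> by (meson less_le_trans zero_less_power)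
    have "a * x\<^sup>2 * K = exp (-1/4) * x\<^sup>2 * (K / 2)" by (simp add: a_def)
    also have "\<dots> \<le> exp (-1/4) * x\<^sup>2 * (K - \<nu> powr (-s) * (2 * M\<^sup>2 + 2 * (sobolev_norm s p0)\<^sup>2))"
      using small K by (intro mult_left_mono) auto
    finally have \<theta>: "a * x\<^sup>2 * K \<le> \<theta>" using \<theta>K by linarith
    have \<theta>0: "\<theta> > 0" using \<theta> a0 x0 K0 by (meson less_le_trans mult_pos_pos zero_less_power)
    have q0: "q \<ge> 0" unfolding q_def by simp
    have e0: "e \<ge> 0" unfolding e_def by (intro Bochner_Integration.integral_nonneg less_imp_le[OF gauss_pos])
    have B': "1 / ((real n)\<^sup>2 * x\<^sup>2) \<le> B" using B unfolding inv x2 by (simp add: mult.commute)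
    have n0: "real n > 0" using n by simp
    define r where "r = 1 / (real n * K * x)"
    have rR: "r \<le> R"
    proof -
      have "r \<le> 1 / (real n * \<Delta>\<^sup>2 * x)" unfolding r_def
        using n0 x0 K0 K \<Delta> by (intro divide_left_mono mult_right_mono mult_left_mono mult_pos_pos) auto
      also have "\<dots> = R" unfolding R_def inv x_def[symmetric] by (simp add: ac_simps)
      finally show ?thesis .
    qed
    have r0: "r \<ge> 0" unfolding r_def using n0 x0 K0 by simp
    have "64 * q / (real n * \<theta>\<^sup>2) + 1024 * e / ((real n)\<^sup>2 * \<theta>\<^sup>2) + 8 * (?z\<^sup>2 + 1) * (17 * e + 1 / (real n)\<^sup>2) / ((real n)\<^sup>2 * \<theta>\<^sup>2)
      \<le> ?A1 * r + ?A2 * r\<^sup>2"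
      unfolding r_def by (rule error_le_rate[OF n0 x0 K0 a0 \<theta> q q0 _ e0 B']) (use e in \<open>simp add: mult.commute\<close>)
    also have "\<dots> \<le> ?A1 * R + ?A2 * R\<^sup>2"
      using rR r0 by (intro add_mono mult_left_mono A0 power_mono)
    finally have err: "64 * q / (real n * \<theta>\<^sup>2) + 1024 * e / ((real n)\<^sup>2 * \<theta>\<^sup>2) + 8 * (?z\<^sup>2 + 1) * (17 * e + 1 / (real n)\<^sup>2) / ((real n)\<^sup>2 * \<theta>\<^sup>2)
      \<le> ?A1 * R + ?A2 * R\<^sup>2" .
    have "sets (law p) = sets borel" by (simp add: law_def)
    from rejection_probability_ge[OF prob[OF pd] this prob[OF p0(1)] \<nu> n \<theta>0[unfolded \<theta>_def \<phi>_def], of ?z]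
    have "1 - (64 * q / (real n * \<theta>\<^sup>2) + 1024 * e / ((real n)\<^sup>2 * \<theta>\<^sup>2) + 8 * (?z\<^sup>2 + 1) * (17 * e + 1 / (real n)\<^sup>2) / ((real n)\<^sup>2 * \<theta>\<^sup>2)) \<le> ?pr p"
      unfolding sample_law_def Phi_GOF_def \<theta>_def[symmetric] \<phi>_def[symmetric] q_def[symmetric] e_def[symmetric] .
    then show ?thesis using err by linarith
  qed
  have le1: "?pr p \<le> 1" if "p \<in> ?H" for p
  proof -
    have "prob_space (sample_law n p)" unfolding sample_law_def
      using that prob by (intro prob_space_PiM) (auto simp: H1_GOF_def)
    then show ?thesis by (rule prob_space.prob_le_1)
  qed
  show "1 - (?A1 * R + ?A2 * R\<^sup>2) \<le> test_power n (Phi_GOF p0 n \<nu> \<alpha>) ?H"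
  proof (cases "?H = {}")
    case True
    have "0 \<le> ?A1 * R + ?A2 * R\<^sup>2" using A0 R0 by (intro add_nonneg_nonneg mult_nonneg_nonneg) auto
    then show ?thesis using True by (simp add: test_power_def)
  next
    case False
    then show ?thesis unfolding test_power_def using pr by (simp add: cINF_greatest)
  qed
  show "test_power n (Phi_GOF p0 n \<nu> \<alpha>) ?H \<le> 1"
  proof (cases "?H = {}")
    case True
    then show ?thesis by (simp add: test_power_def)
  next
    case False
    then obtain p where p: "p \<in> ?H" by blast
    have "(INF p\<in>?H. ?pr p) \<le> ?pr p"
      by (rule cINF_lower[OF _ p]) (rule bdd_belowI2[of _ 0], rule measure_nonneg)
    also note le1[OF p]
    finally show ?thesis using False by (simp add: test_power_def)
  qed
qed

section \<open>Consistency at the minimax separation rate\<close>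

theorem theorem2:
  fixes p0 :: "'a::euclidean_space \<Rightarrow> real"
    and s M \<alpha> :: real
    and \<Delta> \<nu> :: "nat \<Rightarrow> real"
  assumes "s > 0" and "M > 0"
    and "prob_density p0" and "p0 \<in> sobolev s"
    and "\<And>n. n \<ge> 1 \<Longrightarrow> \<Delta> n > 0"
    and "filterlim (\<lambda>n. real n powr (2 * s / (real DIM('a) + 4 * s)) * \<Delta> n) at_top sequentially"
    and "0 < \<alpha>" and "\<alpha> < 1"
    and "same_order \<nu> (\<lambda>n. real n powr (4 / (real DIM('a) + 4 * s)))"
  shows "(\<lambda>n. test_power n (Phi_GOF p0 n (\<nu> n) \<alpha>) (H1_GOF p0 M s (\<Delta> n))) \<longlonglongrightarrow> 1"
proof -
  let ?d = "real DIM('a)"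
  let ?D = "?d + 4 * s"
  define t where "t n = real n powr (2 * s / ?D) * \<Delta> n" for n
  obtain c C where c: "c > 0" and C: "C > 0"
    and cC: "\<And>n. n \<ge> 1 \<Longrightarrow> c \<le> \<nu> n / real n powr (4 / ?D)" "\<And>n. n \<ge> 1 \<Longrightarrow> \<nu> n / real n powr (4 / ?D) \<le> C"
    using assms(9) unfolding same_order_def by metis
  have D: "?D > 0" using assms(1) by (simp add: add_pos_pos)
  define W where "W = 2 * M\<^sup>2 + 2 * (sobolev_norm s p0)\<^sup>2"
  have W: "W \<ge> 0" by (simp add: W_def)
  define B where "B = (C / pi) powr (?d / 2)"
  define C4 where "C4 = (C / pi) powr (?d / 4)"
  define R where "R n = (\<nu> n / pi) powr (?d / 4) / (real n * (\<Delta> n)\<^sup>2)" for n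
  define a :: real where "a = exp (-1/4) / 2"
  define A1 where "A1 = 64 * M / a\<^sup>2"
  define A2 where "A2 = (1024 * M\<^sup>2 + 8 * ((z_upper \<alpha>)\<^sup>2 + 1) * (17 * M\<^sup>2 + B)) / a\<^sup>2"
  have \<nu>lo: "c * real n powr (4 / ?D) \<le> \<nu> n" and \<nu>hi: "\<nu> n \<le> C * real n powr (4 / ?D)" and \<nu>0: "\<nu> n > 0" if "n \<ge> 1" for n
  proof -
    have p: "real n powr (4 / ?D) > 0" using that by simp
    show lo: "c * real n powr (4 / ?D) \<le> \<nu> n" using cC(1)[OF that] p by (simp add: pos_le_divide_eq)
    show "\<nu> n \<le> C * real n powr (4 / ?D)" using cC(2)[OF that] p by (simp add: pos_divide_le_eq)
    have "0 < c * real n powr (4 / ?D)" using p c by simp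
    then show "\<nu> n > 0" using lo by linarith
  qed
  have t2: "(t n)\<^sup>2 = real n powr (4 * s / ?D) * (\<Delta> n)\<^sup>2" for n
  proof -
    have "(real n powr (2 * s / ?D))\<^sup>2 = real n powr (2 * s / ?D + 2 * s / ?D)"
      unfolding power2_eq_square powr_add ..
    also have "2 * s / ?D + 2 * s / ?D = 4 * s / ?D" by simp
    finally show ?thesis unfolding t_def power_mult_distrib by simp
  qed
  have Rle: "0 \<le> R n \<and> R n \<le> C4 / (t n)\<^sup>2" if n: "n \<ge> 1" for n
  proof
    have n0: "real n > 0" using n by simp
    show "0 \<le> R n" unfolding R_def by simp
    have "(\<nu> n / pi) powr (?d / 4) \<le> ((C / pi) * real n powr (4 / ?D)) powr (?d / 4)"
      using \<nu>hi[OF n] \<nu>0[OF n] by (intro powr_mono2) (auto simp: divide_right_mono)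
    also have "\<dots> = C4 * real n powr (4 / ?D * (?d / 4))" by (simp only: powr_mult powr_powr C4_def)
    \<comment> \<open>So n exceeds \<nu>^(D/4) by the factor n^(4s/(D+4s)), the one that multiplies \<Delta>^2 in the square of t.\<close>
    also have "4 / ?D * (?d / 4) = 1 - 4 * s / ?D" using D by (simp add: field_simps)
    also have "C4 * real n powr (1 - 4 * s / ?D) = C4 * real n / real n powr (4 * s / ?D)"
      using n0 by (simp add: powr_diff)
    finally have "R n \<le> (C4 * real n / real n powr (4 * s / ?D)) / (real n * (\<Delta> n)\<^sup>2)"
      unfolding R_def by (intro divide_right_mono) auto
    also have "\<dots> = C4 / (t n)\<^sup>2" unfolding t2 using n0 by simp
    finally show "R n \<le> C4 / (t n)\<^sup>2" .
  qed
  have tt: "filterlim t at_top sequentially" using assms(6) unfolding t_def .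
  then have "filterlim (\<lambda>n. (t n)\<^sup>2) at_top sequentially"
    by (intro filterlim_pow_at_top) auto
  then have inv: "(\<lambda>n. const / (t n)\<^sup>2) \<longlonglongrightarrow> 0" for const :: real
    by (intro tendsto_divide_0[OF tendsto_const] filterlim_at_top_imp_at_infinity)
  have R: "R \<longlonglongrightarrow> 0"
    by (rule tendsto_sandwich[OF _ _ tendsto_const inv[of C4]])
      (use Rle in \<open>auto intro!: eventually_sequentiallyI[of 1]\<close>)
  have "(\<lambda>n. 1 - (A1 * R n + A2 * (R n)\<^sup>2)) \<longlonglongrightarrow> 1 - (A1 * 0 + A2 * 0\<^sup>2)"
    by (intro tendsto_intros R)
  then have low: "(\<lambda>n. 1 - (A1 * R n + A2 * (R n)\<^sup>2)) \<longlonglongrightarrow> 1" by simp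
  have "eventually (\<lambda>n. c powr (-s) * W / (t n)\<^sup>2 < 1 / 2) sequentially"
    by (rule order_tendstoD(2)[OF inv]) simp
  then have ev: "eventually (\<lambda>n. 1 - (A1 * R n + A2 * (R n)\<^sup>2) \<le> test_power n (Phi_GOF p0 n (\<nu> n) \<alpha>) (H1_GOF p0 M s (\<Delta> n))
      \<and> test_power n (Phi_GOF p0 n (\<nu> n) \<alpha>) (H1_GOF p0 M s (\<Delta> n)) \<le> 1) sequentially"
    using eventually_ge_at_top[of 4]
  proof eventually_elim
    case (elim n)
    then have n: "n \<ge> 1" and n0: "real n > 0" by auto
    have \<Delta>0: "\<Delta> n > 0" by (rule assms(5)[OF n])
    have small: "\<nu> n powr (-s) * (2 * M\<^sup>2 + 2 * (sobolev_norm s p0)\<^sup>2) \<le> (\<Delta> n)\<^sup>2 / 2"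
    proof -
      have "\<nu> n powr (-s) \<le> (c * real n powr (4 / ?D)) powr (-s)"
        using \<nu>lo[OF n] c n0 assms(1) by (intro powr_mono2') auto
      also have "\<dots> = c powr (-s) * real n powr (- (4 * s / ?D))"
        by (simp add: powr_mult powr_powr)
      also have "\<dots> = c powr (-s) / (t n)\<^sup>2 * (\<Delta> n)\<^sup>2"
        unfolding t2 using \<Delta>0 by (simp add: powr_minus divide_inverse)
      finally have "\<nu> n powr (-s) * W \<le> c powr (-s) / (t n)\<^sup>2 * (\<Delta> n)\<^sup>2 * W"
        using W by (rule mult_right_mono)
      also have "\<dots> = (c powr (-s) * W / (t n)\<^sup>2) * (\<Delta> n)\<^sup>2" by simp
      also have "\<dots> \<le> 1 / 2 * (\<Delta> n)\<^sup>2" using elim(1) by (intro mult_right_mono) auto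
      finally show ?thesis unfolding W_def by simp
    qed
    have Bn: "(\<nu> n / pi) powr (?d / 2) / (real n)\<^sup>2 \<le> B"
    proof -
      have "(\<nu> n / pi) powr (?d / 2) \<le> ((C / pi) * real n powr (4 / ?D)) powr (?d / 2)"
        using \<nu>hi[OF n] \<nu>0[OF n] by (intro powr_mono2) (auto simp: divide_right_mono)
      also have "\<dots> = B * real n powr (4 / ?D * (?d / 2))" by (simp only: powr_mult powr_powr B_def)
      also have "\<dots> \<le> B * real n powr 2"
        using n D assms(1) by (intro mult_left_mono powr_mono) (auto simp: B_def field_simps)
      also have "real n powr 2 = (real n)\<^sup>2" using n0 by (simp add: powr_numeral)
      finally show ?thesis using n0 by (simp add: divide_le_eq)
    qed
    show ?case
      using test_power_bounds[OF assms(1-4) \<Delta>0 \<nu>0[OF n] elim(2) small Bn, of \<alpha>]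
      unfolding R_def A1_def A2_def a_def by blast
  qed
  show ?thesis
    by (rule tendsto_sandwich[OF _ _ low tendsto_const]) (use ev in \<open>auto elim: eventually_mono\<close>)
qed

end
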